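(* Let $C$ be a full class of finite groups which contains a non-identity group. Let $\mathcal{F}$ be a free pro-$C$ group and $X\subset\mathcal{F}$ a set of free generators (a free basis) of $\mathcal{F}$. If $m\geq 2$ is an integer, then $Z_{\mathcal{F}^m}(x^n)=\langle x\rangle$ for every $x\in X$ and every $n\in\mathbb{Z}-\{0\}$, where $Z_{\mathcal{F}^m}(x^n)$ is the centralizer of $x^n$ in $\mathcal{F}^m$.
   Context: A class $C$ of finite groups (closed under isomorphism) is full if it is closed under taking quotients, subgroups, direct products (of finitely many members) and extensions. A free pro-$C$ group with basis $X$ is the free pro-$C$ group on the set $X$ (for infinite $X$, the basis converges to $1$), that is, a pro-$C$ group $\mathcal{F}$ containing $X$ such that: $X$ topologically generates $\mathcal{F}$; $X$ converges to $1$, i.e. every open normal subgroup of $\mathcal{F}$ contains all but finitely many elements of $X$ (a vacuous condition if $X$ is finite); and every map $\varphi$ from $X$ to a pro-$C$ group $G$ which converges to $1$ (i.e. for every open normal subgroup $N$ of $G$, $\varphi(x)\in N$ for all but finitely many $x\in X$) and whose image topologically generates $G$ extends uniquely to a continuous homomorphism $\mathcal{F}\to G$. For a topological group $G$, $G^{[0]}:=G$, $G^{[m]}:=[G^{[m-1]},G^{[m-1]}]$ (closed subgroup topologically generated by commutators), $G^m:=G/G^{[m]}$. The image of $x\in X$ in $\mathcal{F}^m$ is again denoted $x$, and $\langle x\rangle$ is the closed subgroup topologically generated by $x$ in $\mathcal{F}^m$. *)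

theory Defs
  imports "HOL-Analysis.Analysis" "HOL-Algebra.Generated_Groups" "HOL-Algebra.Product_Groups"
begin

text \<open>The symbol \<open>closure_of\<close> denotes topological closure throughout.\<close>

no_notation eq_closure_of (\<open>closure'_of\<index>\<close>)


section \<open>Full classes of finite groups\<close>

text \<open>
  Every finite group is isomorphic to one whose elements are natural numbers, so a class of finite
  groups closed under isomorphism is given by an isomorphism-closed set of groups carried by sets of
  natural numbers; a group over an arbitrary type is a member of the class when it is isomorphic to
  an element of that set.
\<close>

definition in_class :: "nat monoid set \<Rightarrow> ('a, 'b) monoid_scheme \<Rightarrow> bool" where
  "in_class C G \<longleftrightarrow> group G \<and> (\<exists>H\<in>C. G \<cong> H)"

definition finite_group_class :: "nat monoid set \<Rightarrow> bool" where
  "finite_group_class C \<longleftrightarrow>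
     (\<forall>G\<in>C. group G \<and> finite (carrier G)) \<and>
     (\<forall>G\<in>C. \<forall>H. group H \<and> G \<cong> H \<longrightarrow> H \<in> C)"

definition full_class :: "nat monoid set \<Rightarrow> bool" where
  "full_class C \<longleftrightarrow>
     finite_group_class C \<and>
     (\<forall>G\<in>C. \<forall>N. N \<lhd> G \<longrightarrow> in_class C (G Mod N)) \<and>
     (\<forall>G\<in>C. \<forall>H. subgroup H G \<longrightarrow> in_class C (G\<lparr>carrier := H\<rparr>)) \<and>
     (\<forall>(I :: nat set) K. finite I \<and> (\<forall>i\<in>I. K i \<in> C) \<longrightarrow> in_class C (product_group I K)) \<and>
     (\<forall>(G :: nat monoid) N. group G \<and> N \<lhd> G \<and> in_class C (G\<lparr>carrier := N\<rparr>) \<and> in_class C (G Mod N)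
        \<longrightarrow> in_class C G)"


section \<open>Topological and pro-C groups\<close>

definition topological_group :: "('a, 'b) monoid_scheme \<Rightarrow> 'a topology \<Rightarrow> bool" where
  "topological_group G T \<longleftrightarrow>
     group G \<and> topspace T = carrier G \<and>
     continuous_map (prod_topology T T) T (\<lambda>(x, y). x \<otimes>\<^bsub>G\<^esub> y) \<and>
     continuous_map T T (\<lambda>x. inv\<^bsub>G\<^esub> x)"

definition open_normal :: "('a, 'b) monoid_scheme \<Rightarrow> 'a topology \<Rightarrow> 'a set \<Rightarrow> bool" where
  "open_normal G T N \<longleftrightarrow> N \<lhd> G \<and> openin T N"

text \<open>
  For a compact Hausdorff group, having a neighbourhood base of open normal subgroups at the identity
  says that the group is the inverse limit of its finite quotients by open normal subgroups.
\<close>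

definition profinite_group :: "('a, 'b) monoid_scheme \<Rightarrow> 'a topology \<Rightarrow> bool" where
  "profinite_group G T \<longleftrightarrow>
     topological_group G T \<and> compact_space T \<and> Hausdorff_space T \<and>
     (\<forall>U. openin T U \<and> \<one>\<^bsub>G\<^esub> \<in> U \<longrightarrow> (\<exists>N. open_normal G T N \<and> N \<subseteq> U))"

definition pro_C_group :: "nat monoid set \<Rightarrow> ('a, 'b) monoid_scheme \<Rightarrow> 'a topology \<Rightarrow> bool" where
  "pro_C_group C G T \<longleftrightarrow>
     profinite_group G T \<and> (\<forall>N. open_normal G T N \<longrightarrow> in_class C (G Mod N))"

definition top_generated :: "('a, 'b) monoid_scheme \<Rightarrow> 'a topology \<Rightarrow> 'a set \<Rightarrow> 'a set" where
  "top_generated G T A = T closure_of (generate G A)"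

definition converges_to_one ::
    "'x set \<Rightarrow> ('x \<Rightarrow> 'a) \<Rightarrow> ('a, 'b) monoid_scheme \<Rightarrow> 'a topology \<Rightarrow> bool" where
  "converges_to_one B \<phi> G T \<longleftrightarrow> (\<forall>N. open_normal G T N \<longrightarrow> finite {x\<in>B. \<phi> x \<notin> N})"


section \<open>Free pro-C groups\<close>

text \<open>
  Functions in HOL are total; restricting to \<^const>\<open>extensional\<close> functions makes the
  uniqueness of the extension uniqueness on the carrier.
\<close>

definition extension_property ::
    "('a, 'c) monoid_scheme \<Rightarrow> 'a topology \<Rightarrow> 'a set \<Rightarrow> ('b, 'd) monoid_scheme \<Rightarrow> 'b topology \<Rightarrow> bool"
  where
  "extension_property F T B G S \<longleftrightarrow>
     (\<forall>\<phi>. \<phi> \<in> B \<rightarrow> carrier G \<and> converges_to_one B \<phi> G S \<and> top_generated G S (\<phi> ` B) = carrier G \<longrightarrow>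
        (\<exists>!\<psi>. \<psi> \<in> extensional (carrier F) \<and> \<psi> \<in> hom F G \<and> continuous_map T S \<psi> \<and>
               (\<forall>x\<in>B. \<psi> x = \<phi> x)))"

text \<open>
  A formula cannot quantify over the types carrying the target groups. One type is fixed below, large
  enough for every Hausdorff group that is topologically generated by an image of \<open>B\<close>:
  such a group has a dense subset of values of words in \<open>B\<close>, and its elements are separated
  by the sets of words in whose closure they lie. Theorem \<open>free_pro_C_group_extension\<close> derives the
  extension property for targets over an arbitrary type.
\<close>

type_synonym 'a free_target = "('a \<times> bool) list set set"

definition free_pro_C_group ::
    "nat monoid set \<Rightarrow> 'a monoid \<Rightarrow> 'a topology \<Rightarrow> 'a set \<Rightarrow> bool" where
  "free_pro_C_group C F T B \<longleftrightarrow>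
     pro_C_group C F T \<and> B \<subseteq> carrier F \<and>
     top_generated F T B = carrier F \<and>
     converges_to_one B (\<lambda>x. x) F T \<and>
     (\<forall>(G :: 'a free_target monoid) S. pro_C_group C G S \<longrightarrow> extension_property F T B G S)"


text \<open>The extension property only depends on the target up to isomorphism of topological groups.\<close>

context
  fixes G :: "('b, 'd) monoid_scheme" and S :: "'b topology" and G' :: "('c, 'e) monoid_scheme"
    and S' :: "'c topology" and j :: "'b \<Rightarrow> 'c" and k :: "'c \<Rightarrow> 'b"
  assumes top_grp: "topological_group G S" and grp': "group G'"
    and iso_j: "j \<in> iso G G'" and homeo: "homeomorphic_maps S S' j k"
begin

private lemma grp: "group G" and topsp: "topspace S = carrier G"
  using top_grp by (auto simp: topological_group_def)

private lemma hj: "homeomorphic_map S S' j" and hk: "homeomorphic_map S' S k"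
  and cj: "continuous_map S S' j" and ck: "continuous_map S' S k"
  using homeo unfolding homeomorphic_maps_map by (blast intro: homeomorphic_imp_continuous_map)+

private lemma img: "j ` carrier G = carrier G'"
  using iso_j by (auto simp: iso_def bij_betw_def)

private lemma topsp': "topspace S' = carrier G'"
  using homeomorphic_imp_surjective_map[OF hj] by (simp add: topsp img)

private lemma kj [simp]: "x \<in> carrier G \<Longrightarrow> k (j x) = x"
  and jk [simp]: "y \<in> carrier G' \<Longrightarrow> j (k y) = y"
  using homeo by (auto simp: homeomorphic_maps_map topsp topsp')

private lemma j_in [simp]: "x \<in> carrier G \<Longrightarrow> j x \<in> carrier G'"
  and k_in [simp]: "y \<in> carrier G' \<Longrightarrow> k y \<in> carrier G"
  using img kj by (blast, metis imageE)

private lemma hom_j: "group_hom G G' j"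
  using grp grp' iso_j by (simp add: group_hom_def group_hom_axioms_def iso_def)

private lemma k_hom: "k \<in> hom G' G"
proof (rule homI)
  fix x y assume xy: "x \<in> carrier G'" "y \<in> carrier G'"
  then have "j (k x \<otimes>\<^bsub>G\<^esub> k y) = x \<otimes>\<^bsub>G'\<^esub> y"
    using group_hom.hom_mult[OF hom_j] by simp
  with xy show "k (x \<otimes>\<^bsub>G'\<^esub> y) = k x \<otimes>\<^bsub>G\<^esub> k y"
    using kj grp by (metis k_in group.is_monoid monoid.m_closed)
qed simp

private lemma k_iso: "k \<in> iso G' G"
  using k_hom unfolding iso_def bij_betw_def inj_on_def
  by (auto simp: image_iff) (metis jk, metis j_in kj)

private lemma hom_k: "group_hom G' G k"
  using grp grp' k_hom by (simp add: group_hom_def group_hom_axioms_def)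

private lemma open_normal_image: "open_normal G S N \<Longrightarrow> open_normal G' S' (j ` N)"
  using iso_normal_subgroup[OF iso_j grp grp'] homeomorphic_imp_open_map[OF hj]
  by (auto simp: open_normal_def open_map_def)

private lemma open_normal_image': "open_normal G' S' N \<Longrightarrow> open_normal G S (k ` N)"
  using iso_normal_subgroup[OF k_iso grp' grp] homeomorphic_imp_open_map[OF hk]
  by (auto simp: open_normal_def open_map_def)

private lemma topological_group_transfer: "topological_group G' S'"
  unfolding topological_group_def
proof (intro conjI grp' topsp')
  have m: "continuous_map (prod_topology S S) S (\<lambda>(x, y). x \<otimes>\<^bsub>G\<^esub> y)"
    and i: "continuous_map S S (\<lambda>x. inv\<^bsub>G\<^esub> x)"
    using top_grp by (auto simp: topological_group_def)
  have "continuous_map (prod_topology S' S') S' (j \<circ> ((\<lambda>(x, y). x \<otimes>\<^bsub>G\<^esub> y) \<circ> (\<lambda>(x, y). (k x, k y))))"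
    by (intro continuous_map_compose[OF _ cj] continuous_map_compose[OF _ m])
       (simp add: continuous_map_prod_top ck)
  then show "continuous_map (prod_topology S' S') S' (\<lambda>(x, y). x \<otimes>\<^bsub>G'\<^esub> y)"
    by (rule continuous_map_eq) (auto simp: topsp' group_hom.hom_mult[OF hom_j])
  have "continuous_map S' S' (j \<circ> ((\<lambda>x. inv\<^bsub>G\<^esub> x) \<circ> k))"
    by (intro continuous_map_compose[OF _ cj] continuous_map_compose[OF ck i])
  then show "continuous_map S' S' (\<lambda>x. inv\<^bsub>G'\<^esub> x)"
    by (rule continuous_map_eq) (auto simp: topsp' group_hom.hom_inv[OF hom_j])
qed

private lemma in_class_transfer:
  assumes N: "open_normal G' S' N" and cls: "in_class C (G Mod (k ` N))"
  shows "in_class C (G' Mod N)"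
proof -
  have nN: "N \<lhd> G'" and nk: "k ` N \<lhd> G"
    using N open_normal_image'[OF N] by (auto simp: open_normal_def)
  interpret Q: group "G Mod (k ` N)" using nk by (rule normal.factorgroup_is_group)
  interpret Q': group "G' Mod N" using nN by (rule normal.factorgroup_is_group)
  interpret k: group_hom G' G k by (rule hom_k)
  let ?q = "\<lambda>x. k ` N #>\<^bsub>G\<^esub> k x"
  have "?q \<in> hom G' (G Mod (k ` N))"
    using hom_compose[OF k_hom normal.r_coset_hom_Mod[OF nk]] by (simp add: comp_def)
  then interpret q: group_hom G' "G Mod (k ` N)" ?q
    by unfold_locales
  have "kernel G' (G Mod (k ` N)) ?q = N"
  proof -
    have sub: "subgroup (k ` N) G" "N \<subseteq> carrier G'"
      using nk nN by (auto simp: normal_imp_subgroup subgroup.subset)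
    have "k ` N #>\<^bsub>G\<^esub> k x = k ` N \<longleftrightarrow> x \<in> N" if x: "x \<in> carrier G'" for x
    proof -
      have "k ` N #>\<^bsub>G\<^esub> k x = k ` N \<longleftrightarrow> k x \<in> k ` N"
        using sub x group.coset_join1[OF grp] group.coset_join2[OF grp] by (metis k_in)
      also have "\<dots> \<longleftrightarrow> x \<in> N"
        using x sub(2) by (metis image_iff jk subsetD)
      finally show ?thesis .
    qed
    then show ?thesis using sub(2) by (auto simp: kernel_def)
  qed
  moreover have "?q ` carrier G' = carrier (G Mod (k ` N))"
    unfolding carrier_FactGroup using k_iso by (auto simp: iso_def bij_betw_def image_image[symmetric])
  ultimately have "G' Mod N \<cong> G Mod (k ` N)"
    using q.FactGroup_iso by simp
  with cls show ?thesis
    unfolding in_class_def using Q'.is_group iso_trans by blast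
qed

private lemma pro_C_group_transfer:
  assumes "pro_C_group C G S"
  shows "pro_C_group C G' S'"
proof -
  have P: "compact_space S" "Hausdorff_space S"
    "\<And>U. openin S U \<Longrightarrow> \<one>\<^bsub>G\<^esub> \<in> U \<Longrightarrow> \<exists>N. open_normal G S N \<and> N \<subseteq> U"
    "\<And>N. open_normal G S N \<Longrightarrow> in_class C (G Mod N)"
    using assms by (auto simp: pro_C_group_def profinite_group_def)
  have hs: "S homeomorphic_space S'"
    using homeo by (auto simp: homeomorphic_space_def)
  have "\<exists>N. open_normal G' S' N \<and> N \<subseteq> U" if U: "openin S' U" "\<one>\<^bsub>G'\<^esub> \<in> U" for U
  proof -
    have sU: "U \<subseteq> carrier G'" using openin_subset[OF U(1)] topsp' by simp
    have "openin S (k ` U)"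
      using homeomorphic_imp_open_map[OF hk] U(1) by (simp add: open_map_def)
    moreover have "\<one>\<^bsub>G\<^esub> \<in> k ` U"
      using U(2) group_hom.hom_one[OF hom_k] by (metis imageI)
    ultimately obtain N where N: "open_normal G S N" "N \<subseteq> k ` U" using P(3) by blast
    have "j ` N \<subseteq> U"
    proof
      fix y assume "y \<in> j ` N"
      then obtain u where "u \<in> U" "y = j (k u)" using N(2) by blast
      then show "y \<in> U" using sU by (simp add: subsetD)
    qed
    with open_normal_image[OF N(1)] show ?thesis by blast
  qed
  moreover have "compact_space S'" "Hausdorff_space S'"
    using P(1,2) homeomorphic_compact_space[OF hs] homeomorphic_Hausdorff_space[OF hs] by simp_all
  moreover have "in_class C (G' Mod N)" if "open_normal G' S' N" for N
    using in_class_transfer[OF that P(4)[OF open_normal_image'[OF that]]] .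
  ultimately show ?thesis
    unfolding pro_C_group_def profinite_group_def
    by (intro conjI topological_group_transfer allI impI) auto
qed

private lemma extension_property_transfer:
  assumes F: "group F" "topspace T = carrier F" "B \<subseteq> carrier F"
    and ext: "extension_property F T B G' S'"
  shows "extension_property F T B G S"
  unfolding extension_property_def
proof (intro allI impI)
  fix \<phi> assume \<phi>: "\<phi> \<in> B \<rightarrow> carrier G \<and> converges_to_one B \<phi> G S \<and>
    top_generated G S (\<phi> ` B) = carrier G"
  have pB: "\<phi> ` B \<subseteq> carrier G" using \<phi> by auto
  have 1: "j \<circ> \<phi> \<in> B \<rightarrow> carrier G'" using \<phi> by (simp add: Pi_iff)
  have 2: "converges_to_one B (j \<circ> \<phi>) G' S'"
    unfolding converges_to_one_def
  proof (intro allI impI)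
    fix N assume N: "open_normal G' S' N"
    then have "finite {x \<in> B. \<phi> x \<notin> k ` N}"
      using \<phi> open_normal_image' by (auto simp: converges_to_one_def)
    then show "finite {x \<in> B. (j \<circ> \<phi>) x \<notin> N}"
    proof (rule rev_finite_subset, intro subsetI CollectI)
      fix x assume x: "x \<in> {x \<in> B. (j \<circ> \<phi>) x \<notin> N}"
      have "\<phi> x \<notin> k ` N"
      proof
        assume "\<phi> x \<in> k ` N"
        then obtain y where y: "y \<in> N" "\<phi> x = k y" by blast
        then have "y \<in> carrier G'"
          using N by (meson open_normal_def normal_imp_subgroup subgroup.mem_carrier)
        with x y show False by simp
      qed
      with x show "x \<in> B \<and> \<phi> x \<notin> k ` N" by simp
    qed
  qed
  have "generate G (\<phi> ` B) \<subseteq> topspace S"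
    using group.generate_incl[OF grp pB] topsp by simp
  then have "top_generated G' S' (j ` \<phi> ` B) = j ` top_generated G S (\<phi> ` B)"
    unfolding top_generated_def group_hom.generate_img[OF hom_j pB]
    by (rule homeomorphic_map_closure_of[OF hj])
  then have 3: "top_generated G' S' ((j \<circ> \<phi>) ` B) = carrier G'"
    using \<phi> img by (simp add: image_comp)
  let ?P = "\<lambda>\<psi>. \<psi> \<in> extensional (carrier F) \<and> \<psi> \<in> hom F G' \<and> continuous_map T S' \<psi> \<and>
    (\<forall>x\<in>B. \<psi> x = (j \<circ> \<phi>) x)"
  let ?Q = "\<lambda>\<psi>. \<psi> \<in> extensional (carrier F) \<and> \<psi> \<in> hom F G \<and> continuous_map T S \<psi> \<and>
    (\<forall>x\<in>B. \<psi> x = \<phi> x)"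
  have ex1: "\<exists>!\<psi>. ?P \<psi>"
    using ext 1 2 3 unfolding extension_property_def by blast
  then obtain \<psi>' where \<psi>': "?P \<psi>'" by blast
  have mF: "x \<otimes>\<^bsub>F\<^esub> y \<in> carrier F" if "x \<in> carrier F" "y \<in> carrier F" for x y
    using F(1) that by (simp add: group.is_monoid monoid.m_closed)
  let ?h = "restrict (k \<circ> \<psi>') (carrier F)"
  have h1: "k \<circ> \<psi>' \<in> hom F G"
    using \<psi>' k_hom by (intro hom_compose) auto
  have "continuous_map T S (k \<circ> \<psi>')"
    using \<psi>' ck by (blast intro: continuous_map_compose)
  then have h2: "continuous_map T S ?h"
    by (rule continuous_map_eq) (simp add: F)
  have h3: "?h \<in> hom F G"
    using h1 mF by (auto simp: hom_def Pi_iff)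
  have Qh: "?Q ?h"
    using h2 h3 \<psi>' F(3) pB by (auto simp: image_subset_iff)
  have "\<theta> = ?h" if \<theta>: "?Q \<theta>" for \<theta>
  proof -
    let ?g = "restrict (j \<circ> \<theta>) (carrier F)"
    have "j \<circ> \<theta> \<in> hom F G'"
      using \<theta> group_hom.homh[OF hom_j] by (intro hom_compose) auto
    then have "?g \<in> hom F G'" using mF by (auto simp: hom_def Pi_iff)
    moreover have "continuous_map T S' (j \<circ> \<theta>)"
      using \<theta> cj by (blast intro: continuous_map_compose)
    then have "continuous_map T S' ?g"
      by (rule continuous_map_eq) (simp add: F)
    ultimately have "?P ?g" using \<theta> F(3) by auto
    then have eq: "?g = \<psi>'" using ex1 \<psi>' by blast
    show ?thesis
    proof (rule extensionalityI[of _ "carrier F"])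
      fix x assume x: "x \<in> carrier F"
      then have "\<theta> x \<in> carrier G" using \<theta> by (auto simp: hom_def Pi_iff)
      then show "\<theta> x = ?h x" using x by (simp flip: eq)
    qed (use \<theta> in auto)
  qed
  with Qh show "\<exists>!\<psi>. ?Q \<psi>" by blast
qed

lemmas pro_C_transfer = pro_C_group_transfer extension_property_transfer

end

primrec word_value :: "('b, 'd) monoid_scheme \<Rightarrow> ('a \<Rightarrow> 'b) \<Rightarrow> ('a \<times> bool) list \<Rightarrow> 'b" where
  "word_value G \<phi> [] = \<one>\<^bsub>G\<^esub>"
| "word_value G \<phi> (a # w) =
     (if snd a then \<phi> (fst a) else inv\<^bsub>G\<^esub> (\<phi> (fst a))) \<otimes>\<^bsub>G\<^esub> word_value G \<phi> w"

lemma generate_word_value: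
  assumes "group G" "\<phi> ` B \<subseteq> carrier G"
  shows "generate G (\<phi> ` B) \<subseteq> word_value G \<phi> ` {w. fst ` set w \<subseteq> B}"
proof -
  interpret group G by fact
  have val: "word_value G \<phi> w \<in> carrier G" if "fst ` set w \<subseteq> B" for w
    using that assms(2) by (induction w) auto
  have app: "word_value G \<phi> (v @ w) = word_value G \<phi> v \<otimes>\<^bsub>G\<^esub> word_value G \<phi> w"
    if "fst ` set v \<subseteq> B" "fst ` set w \<subseteq> B" for v w
    using that assms(2) val by (induction v) (auto simp: m_assoc image_subset_iff)
  have "\<exists>w. fst ` set w \<subseteq> B \<and> g = word_value G \<phi> w" if "g \<in> generate G (\<phi> ` B)" for g
    using that
  proof induction
    case one
    show ?case by (rule exI[of _ "[]"]) simp
  next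
    case (incl h)
    then obtain x where "x \<in> B" "h = \<phi> x" by auto
    then show ?case using assms(2) by (intro exI[of _ "[(x, True)]"]) auto
  next
    case (inv h)
    then obtain x where "x \<in> B" "h = \<phi> x" by auto
    then show ?case using assms(2) by (intro exI[of _ "[(x, False)]"]) auto
  next
    case (eng h1 h2)
    then obtain v w where "fst ` set v \<subseteq> B" "h1 = word_value G \<phi> v"
      "fst ` set w \<subseteq> B" "h2 = word_value G \<phi> w" by blast
    then show ?case using app[of v w] by (intro exI[of _ "v @ w"]) auto
  qed
  then show ?thesis by auto
qed

lemma free_target_inj:
  fixes G :: "('b, 'd) monoid_scheme" and \<phi> :: "'a \<Rightarrow> 'b"
  assumes "topological_group G S" "Hausdorff_space S" "\<phi> ` B \<subseteq> carrier G"
    "top_generated G S (\<phi> ` B) = carrier G"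
  shows "inj_on (\<lambda>g. {A. g \<in> S closure_of (word_value G \<phi> ` A)} :: 'a free_target) (carrier G)"
proof (rule inj_onI, rule ccontr)
  fix g h assume gh: "g \<in> carrier G" "h \<in> carrier G" "g \<noteq> h"
    and eq: "{A. g \<in> S closure_of (word_value G \<phi> ` A)} = {A. h \<in> S closure_of (word_value G \<phi> ` A)}"
  have G: "group G" "topspace S = carrier G"
    using assms(1) unfolding topological_group_def by blast+
  obtain U V where UV: "openin S U" "openin S V" "g \<in> U" "h \<in> V" "disjnt U V"
    using assms(2) gh unfolding Hausdorff_space_def by (metis G(2))
  let ?A = "{w. word_value G \<phi> w \<in> U}"
  have "g \<in> S closure_of (word_value G \<phi> ` ?A)"
    unfolding in_closure_of
  proof (intro conjI allI impI)
    show "g \<in> topspace S" using gh G by simp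
    fix W assume W: "g \<in> W \<and> openin S W"
    have "g \<in> S closure_of (generate G (\<phi> ` B))"
      using gh assms(4) by (simp add: top_generated_def)
    then obtain y where "y \<in> generate G (\<phi> ` B)" "y \<in> U \<inter> W"
      unfolding in_closure_of using W UV(1,3) by (meson IntI openin_Int)
    then show "\<exists>y. y \<in> word_value G \<phi> ` ?A \<and> y \<in> W"
      using generate_word_value[OF G(1) assms(3)] by blast
  qed
  then have "h \<in> S closure_of (word_value G \<phi> ` ?A)" using eq by blast
  then obtain y where "y \<in> word_value G \<phi> ` ?A" "y \<in> V"
    unfolding in_closure_of using UV by blast
  then show False using UV(5) by (auto simp: disjnt_def)
qed

theorem free_pro_C_group_extension:
  fixes G :: "('b, 'd) monoid_scheme" and F :: "'a monoid"
  assumes free: "free_pro_C_group C F T B" and G: "pro_C_group C G S"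
  shows "extension_property F T B G S"
proof (cases "\<exists>\<phi>. \<phi> \<in> B \<rightarrow> carrier G \<and> top_generated G S (\<phi> ` B) = carrier G")
  case False
  then show ?thesis unfolding extension_property_def by blast
next
  case True
  then obtain \<phi> where \<phi>: "\<phi> ` B \<subseteq> carrier G" "top_generated G S (\<phi> ` B) = carrier G"
    unfolding image_subset_iff_funcset by blast
  have tg: "topological_group G S" "Hausdorff_space S" and grp: "group G"
    and topsp: "topspace S = carrier G"
    using G unfolding pro_C_group_def profinite_group_def topological_group_def by blast+
  interpret group G by (rule grp)
  define j where "j = (\<lambda>g. {A. g \<in> S closure_of (word_value G \<phi> ` A)} :: 'a free_target)"
  define k where "k = inv_into (carrier G) j"
  have inj: "inj_on j (carrier G)"
    unfolding j_def using free_target_inj[OF tg \<phi>] .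
  have kj [simp]: "k (j x) = x" if "x \<in> carrier G" for x
    using inj that by (simp add: k_def)
  define G' :: "'a free_target monoid" where
    "G' = \<lparr>carrier = j ` carrier G, mult = (\<lambda>u v. j (k u \<otimes>\<^bsub>G\<^esub> k v)), one = j \<one>\<^bsub>G\<^esub>\<rparr>"
  define S' where "S' = pullback_topology (j ` carrier G) k S"
  have "monoid G'"
    by unfold_locales (auto simp: G'_def m_assoc)
  moreover have iso: "j \<in> iso G G'"
    using inj by (auto simp: iso_def hom_def bij_betw_def G'_def)
  ultimately have grp': "group G'"
    using iso_imp_group is_isoI by blast
  have homeo: "homeomorphic_maps S S' j k"
    unfolding homeomorphic_maps_def
  proof (intro conjI ballI)
    have "continuous_map S S (k \<circ> j)"
      using continuous_map_id[of S] by (rule continuous_map_eq) (simp add: topsp)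
    then show "continuous_map S S' j"
      unfolding S'_def by (rule continuous_map_pullback') (auto simp: topsp)
    have "continuous_map S' S (id \<circ> k)"
      unfolding S'_def by (rule continuous_map_pullback) simp
    then show "continuous_map S' S k" by simp
  qed (auto simp: topsp S'_def topspace_pullback_topology)
  have "pro_C_group C G' S'"
    using pro_C_transfer(1)[OF tg(1) grp' iso homeo G] .
  then have "extension_property F T B G' S'"
    using free unfolding free_pro_C_group_def by blast
  moreover have F: "pro_C_group C F T" "B \<subseteq> carrier F"
    using free by (simp_all only: free_pro_C_group_def)
  moreover have "group F" "topspace T = carrier F"
    using F(1) by (simp_all only: pro_C_group_def profinite_group_def topological_group_def)
  ultimately show ?thesis
    by (intro pro_C_transfer(2)[OF tg(1) grp' iso homeo])
qed


section \<open>The closed derived series and its quotients\<close>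

primrec closed_derived :: "('a, 'b) monoid_scheme \<Rightarrow> 'a topology \<Rightarrow> nat \<Rightarrow> 'a set" where
  "closed_derived G T 0 = carrier G"
| "closed_derived G T (Suc m) = top_generated G T (derived_set G (closed_derived G T m))"

definition quotient_group_topology ::
    "('a, 'b) monoid_scheme \<Rightarrow> 'a topology \<Rightarrow> 'a set \<Rightarrow> 'a set topology" where
  "quotient_group_topology G T N =
     topology (\<lambda>U. U \<subseteq> carrier (G Mod N) \<and> openin T {g \<in> topspace T. N #>\<^bsub>G\<^esub> g \<in> U})"

lemma openin_quotient_group_topology:
  "openin (quotient_group_topology G T N) U \<longleftrightarrow>
     U \<subseteq> carrier (G Mod N) \<and> openin T {g \<in> topspace T. N #>\<^bsub>G\<^esub> g \<in> U}"
proof -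
  have "istopology (\<lambda>U. U \<subseteq> carrier (G Mod N) \<and> openin T {g \<in> topspace T. N #>\<^bsub>G\<^esub> g \<in> U})"
    unfolding istopology_def
  proof (intro conjI allI impI, goal_cases)
    case (2 A B)
    have "{g \<in> topspace T. N #>\<^bsub>G\<^esub> g \<in> A \<inter> B} =
        {g \<in> topspace T. N #>\<^bsub>G\<^esub> g \<in> A} \<inter> {g \<in> topspace T. N #>\<^bsub>G\<^esub> g \<in> B}" by auto
    with 2 show ?case by auto
  next
    case (4 \<K>)
    have "{g \<in> topspace T. N #>\<^bsub>G\<^esub> g \<in> \<Union>\<K>} = (\<Union>K\<in>\<K>. {g \<in> topspace T. N #>\<^bsub>G\<^esub> g \<in> K})" by auto
    with 4 show ?case by auto
  qed auto
  then show ?thesis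
    unfolding quotient_group_topology_def by (simp add: topology_inverse')
qed

abbreviation derived_quotient :: "('a, 'b) monoid_scheme \<Rightarrow> 'a topology \<Rightarrow> nat \<Rightarrow> 'a set monoid" where
  "derived_quotient G T m \<equiv> G Mod (closed_derived G T m)"

abbreviation derived_quotient_topology ::
    "('a, 'b) monoid_scheme \<Rightarrow> 'a topology \<Rightarrow> nat \<Rightarrow> 'a set topology" where
  "derived_quotient_topology G T m \<equiv> quotient_group_topology G T (closed_derived G T m)"

definition centralizer :: "('a, 'b) monoid_scheme \<Rightarrow> 'a \<Rightarrow> 'a set" where
  "centralizer G a = {g \<in> carrier G. g \<otimes>\<^bsub>G\<^esub> a = a \<otimes>\<^bsub>G\<^esub> g}"

end

theory Submission
  imports Defs "HOL-Algebra.Multiplicative_Group" "HOL-Algebra.Sylow"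
begin

text \<open>Write \<open>F\<^sup>(\<^sup>i\<^sup>)\<close> for the closed derived series. Powers of \<open>x\<close> commute
with \<open>x\<^sup>n\<close>, and the centralizer is closed because \<open>F\<^sup>(\<^sup>m\<^sup>)\<close>
is; so the closure of the powers of \<open>x\<close> lies in the centralizer. Conversely let \<open>g\<close>
commute with \<open>x\<^sup>n\<close> modulo \<open>F\<^sup>(\<^sup>m\<^sup>)\<close>. It has to be shown that
\<open>g\<close> is congruent to a power of \<open>x\<close> modulo every open normal \<open>N\<close>
containing \<open>F\<^sup>(\<^sup>m\<^sup>)\<close>.

The tool is a finite form of Fox calculus. Let \<open>V\<close> be open and normal and \<open>A\<close> a finite
abelian group in the class. A crossed map assigns to \<open>w\<close> and \<open>k\<close> a value
\<open>d w k\<close> in \<open>A\<close> that depends only on the coset \<open>V k\<close>, with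
\<open>d (w w') k = d w k \<cdot> d w' (k w)\<close>. Crossed maps are the first components of
homomorphisms into the wreath product of \<open>A\<close> by \<open>F/V\<close>, which is again in the class.
Hence, \<open>F\<close> being free, the functions \<open>d y\<close> can be prescribed on the basis
(\<open>exists_crossed_map\<close>). If \<open>F\<^sup>(\<^sup>m\<^sup>-\<^sup>1\<^sup>)\<close> lies in
\<open>V\<close>, then \<open>d\<close> is trivial on \<open>F\<^sup>(\<^sup>m\<^sup>)\<close>, and elements
\<open>g\<close>, \<open>u\<close> that commute modulo \<open>F\<^sup>(\<^sup>m\<^sup>)\<close> satisfy
\<open>d g k \<cdot> d u (k g) = d u k \<cdot> d g (k u)\<close>. Two such maps suffice.

First (\<open>centralizer_of_power_mod_open_normal\<close>), let \<open>V\<close> contain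
\<open>F\<^sup>(\<^sup>m\<^sup>-\<^sup>1\<^sup>)\<close>, let \<open>A\<close> be cyclic of order not dividing
\<open>n\<close>, let \<open>d x\<close> be the indicator of \<open>V\<close> and \<open>d y\<close> trivial
on the other basis elements. Then \<open>d (x\<^sup>l) k\<close> counts the \<open>j < l\<close> with
\<open>k x\<^sup>j\<close> in \<open>V\<close>. If \<open>x\<close> has order \<open>r\<close> modulo
\<open>V\<close>, then \<open>w = x\<^sup>n\<^sup>r\<close> lies in \<open>V\<close>, and the commutation
identity becomes \<open>d w g = d w 1\<close>, where \<open>d w 1\<close> is the class of
\<open>n\<close> and not zero. So some \<open>g x\<^sup>j\<close> lies in \<open>V\<close>: modulo
\<open>V\<close>, the element \<open>g\<close> is a power of \<open>x\<close>.

Second (\<open>centralizer_of_power_mod_derived\<close>), let \<open>N\<close> contain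
\<open>F\<^sup>(\<^sup>m\<^sup>)\<close>, put \<open>U = N F\<^sup>(\<^sup>m\<^sup>-\<^sup>1\<^sup>)\<close>
and take the abelian group \<open>A = U/N\<close>. The embedding of \<open>F/N\<close> into the wreath product
of \<open>A\<close> by \<open>F/U\<close> provides a crossed map \<open>\<kappa>\<close> that detects membership
in \<open>N\<close>. Since \<open>m \<ge> 2\<close>, every continuous homomorphism to a finite cyclic group
kills \<open>F\<^sup>(\<^sup>m\<^sup>-\<^sup>1\<^sup>)\<close>, so \<open>U\<close> contains an open normal
\<open>V\<close>, still containing \<open>F\<^sup>(\<^sup>m\<^sup>-\<^sup>1\<^sup>)\<close>, modulo which some
power \<open>z\<close> of \<open>x\<^sup>n\<close> lying in \<open>U\<close> has order exactly
\<open>|A|\<close>. Freeness lifts \<open>\<kappa>\<close> to a crossed map \<open>d\<close> over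
\<open>F/V\<close> such that \<open>\<kappa> w k\<close> is the product of the
\<open>d w (z\<^sup>l k)\<close> for \<open>l < |A|\<close>. By the first part
\<open>g = g' x\<^sup>j\<close> with \<open>g'\<close> in \<open>V\<close>. Now \<open>g'\<close> commutes
with \<open>z\<close> modulo \<open>F\<^sup>(\<^sup>m\<^sup>)\<close>, so all the factors
\<open>d g' (z\<^sup>l)\<close> are equal, and \<open>\<kappa> g' 1\<close> is an \<open>|A|\<close>-th
power, hence trivial. Therefore \<open>g'\<close> lies in \<open>N\<close>.\<close>

section \<open>Full classes and groups over arbitrary types\<close>

lemma full_class_memD:
  assumes "full_class C" "G \<in> C"
  shows "group G" "finite (carrier G)"
  using assms by (auto simp: full_class_def finite_group_class_def)

lemma full_class_quotientD: "full_class C \<Longrightarrow> G \<in> C \<Longrightarrow> N \<lhd> G \<Longrightarrow> in_class C (G Mod N)"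
  and full_class_subgroupD: "full_class C \<Longrightarrow> G \<in> C \<Longrightarrow> subgroup H G \<Longrightarrow> in_class C (G\<lparr>carrier := H\<rparr>)"
  by (simp_all add: full_class_def)

lemma full_class_extensionD:
  fixes G :: "nat monoid"
  assumes "full_class C" "group G" "N \<lhd> G" "in_class C (G\<lparr>carrier := N\<rparr>)" "in_class C (G Mod N)"
  shows "in_class C G"
  using assms unfolding full_class_def by meson

lemma in_class_group: "in_class C G \<Longrightarrow> group G"
  by (simp add: in_class_def)

lemma in_class_finite:
  assumes "full_class C" "in_class C G"
  shows "finite (carrier G)"
  using assms iso_finite full_class_memD(2) unfolding in_class_def by blast

lemma in_class_iso:
  assumes "in_class C G" "group H" "H \<cong> G"
  shows "in_class C H"
  using assms iso_trans unfolding in_class_def by blast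

lemma in_class_subgroup:
  assumes C: "full_class C" and K: "in_class C K" and H: "subgroup H K"
  shows "in_class C (K\<lparr>carrier := H\<rparr>)"
proof -
  obtain L j where L: "L \<in> C" "j \<in> iso K L" and gK: "group K"
    using K by (auto simp: in_class_def is_iso_def)
  have gL: "group L" using full_class_memD(1)[OF C L(1)] .
  have sub: "subgroup (j ` H) L"
    using subgroup.iso_subgroup[OF H gK gL L(2)] .
  then have "in_class C (L\<lparr>carrier := j ` H\<rparr>)"
    using full_class_subgroupD[OF C L(1)] by blast
  moreover have "K\<lparr>carrier := H\<rparr> \<cong> L\<lparr>carrier := j ` H\<rparr>"
    using iso_restrict[OF L(2) gK gL H] is_isoI by blast
  ultimately show ?thesis
    using in_class_iso subgroup.subgroup_is_group[OF H gK] by blast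
qed

lemma group_nat_copy:
  fixes G :: "('a, 'b) monoid_scheme"
  assumes "group G" "finite (carrier G)"
  obtains G' :: "nat monoid" and j where "group G'" "j \<in> iso G G'"
proof -
  interpret group G by fact
  obtain j :: "'a \<Rightarrow> nat" where inj: "inj_on j (carrier G)"
    using assms(2) finite_imp_inj_to_nat_seg by metis
  define k where "k = inv_into (carrier G) j"
  have kj [simp]: "k (j x) = x" if "x \<in> carrier G" for x
    using inj that by (simp add: k_def)
  define G' :: "nat monoid" where
    "G' = \<lparr>carrier = j ` carrier G, mult = (\<lambda>u v. j (k u \<otimes>\<^bsub>G\<^esub> k v)), one = j \<one>\<^bsub>G\<^esub>\<rparr>"
  have "monoid G'"
    by unfold_locales (auto simp: G'_def m_assoc)
  moreover have iso: "j \<in> iso G G'"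
    using inj by (auto simp: iso_def hom_def bij_betw_def G'_def)
  ultimately show ?thesis
    using that iso_imp_group is_isoI by blast
qed

lemma in_class_image:
  assumes C: "full_class C" and G: "group G" and f: "f \<in> hom G K" and K: "in_class C K"
  shows "in_class C (G Mod (kernel G K f))"
proof -
  interpret f: group_hom G K f
    using G f in_class_group[OF K] by (simp add: group_hom_def group_hom_axioms_def)
  interpret g: group_hom G "K\<lparr>carrier := f ` carrier G\<rparr>" f
  proof -
    show "group_hom G (K\<lparr>carrier := f ` carrier G\<rparr>) f"
      using f.induced_group_hom[OF group.subgroup_self[OF G]] by simp
  qed
  have "G Mod (kernel G K f) \<cong> K\<lparr>carrier := f ` carrier G\<rparr>"
    using g.FactGroup_iso by (simp add: kernel_def)
  moreover have "group (G Mod (kernel G K f))"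
    using f.normal_kernel normal.factorgroup_is_group by blast
  ultimately show ?thesis
    using in_class_subgroup[OF C K f.img_is_subgroup] in_class_iso by blast
qed

text \<open>Extensions in the class are only given for groups of natural numbers. A finite group has a copy of that kind,
and presenting the extension by a homomorphism lets the hypotheses be carried over to it.\<close>

lemma in_class_extension:
  assumes C: "full_class C" and G: "group G" "finite (carrier G)"
    and f: "f \<in> hom G K" and K: "in_class C K"
    and ker: "in_class C (G\<lparr>carrier := kernel G K f\<rparr>)"
  shows "in_class C G"
proof -
  obtain G' :: "nat monoid" and j where G': "group G'" and j: "j \<in> iso G G'"
    using group_nat_copy[OF G] .
  define k where "k = inv_into (carrier G) j"
  have k: "k \<in> iso G' G"
    using group.iso_set_sym[OF G(1) j] by (simp add: k_def)
  have fk: "f \<circ> k \<in> hom G' K"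
    using k f by (intro hom_compose) (auto simp: iso_def)
  let ?N = "kernel G' K (f \<circ> k)"
  interpret f: group_hom G' K "f \<circ> k"
    using G' fk in_class_group[OF K] by (simp add: group_hom_def group_hom_axioms_def)
  have img: "k ` ?N = kernel G K f"
  proof (intro equalityI subsetI)
    fix y assume y: "y \<in> kernel G K f"
    then have "y \<in> k ` carrier G'"
      using k by (simp add: kernel_def iso_def bij_betw_def)
    then obtain x where x: "x \<in> carrier G'" "y = k x" by blast
    then have "x \<in> ?N" using y by (simp add: kernel_def)
    then show "y \<in> k ` ?N" using x(2) by blast
  next
    fix y assume "y \<in> k ` ?N"
    then obtain x where "x \<in> carrier G'" "f (k x) = \<one>\<^bsub>K\<^esub>" "y = k x"
      by (auto simp: kernel_def)
    then show "y \<in> kernel G K f"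
      using k by (auto simp: kernel_def iso_def hom_def)
  qed
  have "restrict k ?N \<in> iso (G'\<lparr>carrier := ?N\<rparr>) (G\<lparr>carrier := kernel G K f\<rparr>)"
    using iso_restrict[OF k G' G(1) f.subgroup_kernel] by (simp add: img)
  then have "in_class C (G'\<lparr>carrier := ?N\<rparr>)"
    using in_class_iso[OF ker] is_isoI subgroup.subgroup_is_group[OF f.subgroup_kernel G'] by blast
  moreover have "in_class C (G' Mod ?N)"
    using in_class_image[OF C G' fk K] .
  ultimately have "in_class C G'"
    using full_class_extensionD[OF C G' f.normal_kernel] by blast
  then show ?thesis
    using in_class_iso G(1) j is_isoI by blast
qed

lemma in_class_quotient:
  assumes C: "full_class C" and K: "in_class C K" and N: "N \<lhd> K"
  shows "in_class C (K Mod N)"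
proof -
  obtain L j where L: "L \<in> C" "j \<in> iso K L" and gK: "group K"
    using K by (auto simp: in_class_def is_iso_def)
  have gL: "group L" using full_class_memD(1)[OF C L(1)] .
  have nj: "j ` N \<lhd> L"
    using iso_normal_subgroup[OF L(2) gK gL N] .
  then have cl: "in_class C (L Mod (j ` N))"
    using full_class_quotientD[OF C L(1)] by blast
  let ?q = "(\<lambda>x. j ` N #>\<^bsub>L\<^esub> x) \<circ> j"
  have q: "?q \<in> hom K (L Mod (j ` N))"
    using L(2) by (intro hom_compose[OF _ normal.r_coset_hom_Mod[OF nj]]) (simp add: iso_def)
  have sN: "N \<subseteq> carrier K" using N normal_imp_subgroup subgroup.subset by blast
  have sub: "subgroup (j ` N) L" using nj normal_imp_subgroup by blast
  have "kernel K (L Mod (j ` N)) ?q = N"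
  proof -
    have "j ` N #>\<^bsub>L\<^esub> j x = j ` N \<longleftrightarrow> x \<in> N" if x: "x \<in> carrier K" for x
    proof -
      have jx: "j x \<in> carrier L" using L(2) x by (auto simp: iso_def hom_def)
      have "j ` N #>\<^bsub>L\<^esub> j x = j ` N \<longleftrightarrow> j x \<in> j ` N"
        using jx sub subgroup.subset[OF sub] group.coset_join1[OF gL] group.coset_join2[OF gL] by metis
      also have "\<dots> \<longleftrightarrow> x \<in> N"
        using x sN L(2) by (auto simp: iso_def bij_betw_def inj_on_def)
      finally show ?thesis .
    qed
    then show ?thesis using sN by (auto simp: kernel_def)
  qed
  then show ?thesis using in_class_image[OF C gK q cl] by simp
qed

lemma in_class_trivial:
  assumes C: "full_class C" "C \<noteq> {}" and G: "group G" "carrier G = {\<one>\<^bsub>G\<^esub>}"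
  shows "in_class C G"
proof -
  obtain K where K: "K \<in> C" using C by blast
  have gK: "group K" using full_class_memD(1)[OF C(1) K] .
  have K': "in_class C K"
    using K gK iso_refl in_class_def by blast
  have sub: "subgroup {\<one>\<^bsub>K\<^esub>} K" using gK group.triv_subgroup by blast
  have "(\<lambda>_. \<one>\<^bsub>K\<^esub>) \<in> iso G (K\<lparr>carrier := {\<one>\<^bsub>K\<^esub>}\<rparr>)"
    using G gK by (auto simp: iso_def hom_def bij_betw_def group.is_monoid)
  then show ?thesis
    using in_class_iso[OF in_class_subgroup[OF C(1) K' sub] G(1)] is_isoI by blast
qed

text \<open>Peeling off the homomorphisms one at a time, the common kernel of the first ones
  shrinks to the trivial group, and each step is an extension.\<close>

lemma in_class_residual:
  fixes G :: "('a, 'b) monoid_scheme" and K :: "'i \<Rightarrow> ('c, 'd) monoid_scheme"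
  assumes C: "full_class C" "C \<noteq> {}" and I: "finite I"
    and G: "group G" "finite (carrier G)"
    and f: "\<And>i. i \<in> I \<Longrightarrow> f i \<in> hom G (K i)" "\<And>i. i \<in> I \<Longrightarrow> in_class C (K i)"
    and triv: "\<And>g. g \<in> carrier G \<Longrightarrow> (\<And>i. i \<in> I \<Longrightarrow> f i g = \<one>\<^bsub>K i\<^esub>) \<Longrightarrow> g = \<one>\<^bsub>G\<^esub>"
  shows "in_class C G"
  using I G f triv
proof (induction I arbitrary: G rule: finite_induct)
  case empty
  then have "carrier G = {\<one>\<^bsub>G\<^esub>}"
    using monoid.one_closed[OF group.is_monoid] by blast
  then show ?case using in_class_trivial[OF C] empty by blast
next
  case (insert i I)
  let ?N = "kernel G (K i) (f i)"
  have "group_hom G (K i) (f i)"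
    using insert.prems(1,3) in_class_group[OF insert.prems(4)]
    by (simp add: group_hom_def group_hom_axioms_def)
  then have sub: "subgroup ?N G"
    by (rule group_hom.subgroup_kernel)
  have sN: "?N \<subseteq> carrier G" by (auto simp: kernel_def)
  have "in_class C (G\<lparr>carrier := ?N\<rparr>)"
  proof (rule insert.IH)
    show "group (G\<lparr>carrier := ?N\<rparr>)"
      using subgroup.subgroup_is_group[OF sub insert.prems(1)] .
    show "finite (carrier (G\<lparr>carrier := ?N\<rparr>))"
      using insert.prems(2) sN finite_subset by simp
    show "f l \<in> hom (G\<lparr>carrier := ?N\<rparr>) (K l)" if "l \<in> I" for l
      using insert.prems(3)[of l] that sN by (auto simp: hom_def Pi_iff subset_iff)
    show "in_class C (K l)" if "l \<in> I" for l
      using insert.prems(4) that by blast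
    show "g = \<one>\<^bsub>G\<lparr>carrier := ?N\<rparr>\<^esub>"
      if "g \<in> carrier (G\<lparr>carrier := ?N\<rparr>)" "\<And>l. l \<in> I \<Longrightarrow> f l g = \<one>\<^bsub>K l\<^esub>" for g
      using insert.prems(5)[of g] that by (auto simp: kernel_def)
  qed
  then show ?case
    using in_class_extension[OF C(1) insert.prems(1,2)] insert.prems(3,4) by blast
qed

corollary in_class_embedding:
  assumes "full_class C" "C \<noteq> {}" "group G" "finite (carrier G)" "f \<in> hom G K" "in_class C K"
    and "\<And>g. g \<in> carrier G \<Longrightarrow> f g = \<one>\<^bsub>K\<^esub> \<Longrightarrow> g = \<one>\<^bsub>G\<^esub>"
  shows "in_class C G"
  by (rule in_class_residual[where I = "{()}" and f = "\<lambda>_. f" and K = "\<lambda>_. K"]) (use assms in auto)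

text \<open>This is Cauchy's theorem: a subgroup of order \<open>p\<close>, as provided by Sylow's theorem, is generated by
each of its nontrivial elements.\<close>

lemma in_class_prime_cyclic:
  fixes G (structure)
  assumes C: "full_class C" "C \<noteq> {}" and G: "in_class C G" and p: "prime p" "p dvd order G"
  shows "in_class C (integer_mod_group p)"
proof -
  interpret group G using in_class_group[OF G] .
  have fin: "finite (carrier G)" using in_class_finite[OF C(1) G] .
  obtain r where r: "order G = p ^ 1 * r" using p(2) by auto
  obtain H where H: "subgroup H G" "card H = p"
    using sylow_thm[OF p(1) is_group r fin] by auto
  have "1 < card H" using H p(1) prime_gt_1_nat by auto
  then have "\<not> H \<subseteq> {\<one>}"
    using card_mono[of "{\<one>}" H] by auto
  then obtain a where a: "a \<in> H" "a \<noteq> \<one>" by blast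
  interpret H: group "G\<lparr>carrier := H\<rparr>" using subgroup.subgroup_is_group[OF H(1) is_group] .
  have ac: "a \<in> carrier G" using subgroup.mem_carrier[OF H(1) a(1)] .
  have "a [^]\<^bsub>G\<lparr>carrier := H\<rparr>\<^esub> order (G\<lparr>carrier := H\<rparr>) = \<one>"
    using H.pow_order_eq_1[of a] a by simp
  then have "a [^] p = \<one>"
    using H(2) by (simp add: order_def nat_pow_consistent[symmetric])
  then have "ord a dvd p" using pow_eq_id[OF ac] by simp
  moreover have "ord a \<noteq> 1" using ord_eq_1[OF ac] a(2) by simp
  ultimately have ord: "ord a = p" using p(1) by (metis prime_nat_iff)
  have hom: "(\<lambda>i. a [^] i) \<in> hom (integer_mod_group p) G"
  proof (rule homI)
    fix i l :: int
    have "a [^] ((i + l) mod int p) = a [^] (i + l)"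
      using int_pow_eq[OF ac, of "(i + l) mod int p" "i + l"] ord by (simp add: minus_mod_eq_mult_div)
    then show "a [^] (i \<otimes>\<^bsub>integer_mod_group p\<^esub> l) = a [^] i \<otimes> a [^] l"
      by (simp add: int_pow_mult ac)
  qed (simp add: ac)
  show ?thesis
  proof (rule in_class_embedding[OF C group_integer_mod_group _ hom G])
    show "finite (carrier (integer_mod_group p))"
      using p(1) by (simp add: carrier_integer_mod_group)
    show "i = \<one>\<^bsub>integer_mod_group p\<^esub>" if i: "i \<in> carrier (integer_mod_group p)" "a [^] i = \<one>" for i
    proof -
      have "int p dvd i" using int_pow_eq_id[OF ac] ord i by simp
      moreover have "0 \<le> i" "i < int p"
        using i(1) p(1) by (auto simp: carrier_integer_mod_group split: if_splits)
      ultimately show ?thesis using zdvd_not_zless[of i "int p"] by force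
    qed
  qed
qed

text \<open>Reduction modulo \<open>M/p\<close> has a kernel of order \<open>p\<close>, so one prime at a time can be
stripped off by an extension.\<close>

lemma in_class_cyclic:
  assumes C: "full_class C" "C \<noteq> {}" and "M > 0"
    and "\<And>p. prime p \<Longrightarrow> p dvd M \<Longrightarrow> in_class C (integer_mod_group p)"
  shows "in_class C (integer_mod_group M)"
  using assms(3,4)
proof (induction M rule: less_induct)
  case (less M)
  show ?case
  proof (cases "M = 1")
    case True
    then show ?thesis by (intro in_class_trivial[OF C]) (auto simp: carrier_integer_mod_group)
  next
    case False
    then obtain p where p: "prime p" "p dvd M" using prime_factor_nat by blast
    then obtain L where L: "M = p * L" by auto
    have p1: "p > 1" using p prime_gt_1_nat by blast
    have L0: "L > 0" "L < M" using less.prems L p1 by auto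
    have LC: "in_class C (integer_mod_group L)"
      using less.IH[OF L0(2,1)] less.prems L by simp
    have M0: "M > 0" by fact
    have M_eq: "int M = int p * int L" by (simp add: L)
    let ?f = "\<lambda>i::int. i mod int L"
    have f: "?f \<in> hom (integer_mod_group M) (integer_mod_group L)"
    proof (rule homI)
      fix i l :: int
      show "?f i \<in> carrier (integer_mod_group L)"
        using L0 by (simp add: carrier_integer_mod_group)
      have "(i + l) mod int M mod int L = (i + l) mod int L"
        by (rule mod_mod_cancel) (simp add: L)
      also have "\<dots> = (i mod int L + l mod int L) mod int L"
        by (rule mod_add_eq[symmetric])
      finally show "?f (i \<otimes>\<^bsub>integer_mod_group M\<^esub> l) = ?f i \<otimes>\<^bsub>integer_mod_group L\<^esub> ?f l"
        by simp
    qed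
    interpret f: group_hom "integer_mod_group M" "integer_mod_group L" ?f
      using f by (simp add: group_hom_def group_hom_axioms_def)
    let ?N = "kernel (integer_mod_group M) (integer_mod_group L) ?f"
    have N: "int L dvd i \<and> 0 \<le> i \<and> i < int M" if "i \<in> ?N" for i
      using that M0 by (auto simp: kernel_def carrier_integer_mod_group)
    have "in_class C ((integer_mod_group M)\<lparr>carrier := ?N\<rparr>)"
    proof (rule in_class_embedding[OF C, where f = "\<lambda>i. i div int L" and K = "integer_mod_group p"])
      show "group ((integer_mod_group M)\<lparr>carrier := ?N\<rparr>)"
        using subgroup.subgroup_is_group[OF f.subgroup_kernel] by simp
      show "finite (carrier ((integer_mod_group M)\<lparr>carrier := ?N\<rparr>))"
        using M0 by (auto intro: finite_subset[of _ "{0..<int M}"] simp: kernel_def carrier_integer_mod_group)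
      show "in_class C (integer_mod_group p)" using less.prems(2) p by blast
      show "(\<lambda>i. i div int L) \<in> hom ((integer_mod_group M)\<lparr>carrier := ?N\<rparr>) (integer_mod_group p)"
      proof (rule homI)
        fix i assume "i \<in> carrier ((integer_mod_group M)\<lparr>carrier := ?N\<rparr>)"
        then have i: "int L dvd i" "0 \<le> i" "i < int p * int L"
          using N[of i] unfolding M_eq[symmetric] by simp_all
        then obtain i' where i': "i = int L * i'" by blast
        with i L0 have "0 \<le> i'" "i' < int p"
          by (simp_all add: zero_le_mult_iff mult.commute)
        then show "i div int L \<in> carrier (integer_mod_group p)"
          using p1 L0 i' by (simp add: carrier_integer_mod_group)
      next
        fix i l
        assume "i \<in> carrier ((integer_mod_group M)\<lparr>carrier := ?N\<rparr>)"
          "l \<in> carrier ((integer_mod_group M)\<lparr>carrier := ?N\<rparr>)"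
        then have "int L dvd i" "int L dvd l" using N[of i] N[of l] by simp_all
        then obtain i' l' where "i = int L * i'" "l = int L * l'" by blast
        moreover have "(int L * i' + int L * l') mod (int L * int p) = int L * ((i' + l') mod int p)"
          by (simp add: mult_mod_right distrib_left)
        ultimately show "(i \<otimes>\<^bsub>(integer_mod_group M)\<lparr>carrier := ?N\<rparr>\<^esub> l) div int L
            = (i div int L) \<otimes>\<^bsub>integer_mod_group p\<^esub> (l div int L)"
          using L0 by (simp add: M_eq mult.commute[of "int p"])
      qed
      fix i assume i: "i \<in> carrier ((integer_mod_group M)\<lparr>carrier := ?N\<rparr>)"
        "i div int L = \<one>\<^bsub>integer_mod_group p\<^esub>"
      then have "int L dvd i" using N[of i] by simp
      then have "i = int L * (i div int L)" by simp
      then show "i = \<one>\<^bsub>(integer_mod_group M)\<lparr>carrier := ?N\<rparr>\<^esub>"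
        using i(2) by simp
    qed
    then show ?thesis
      using in_class_extension[OF C(1) group_integer_mod_group _ f LC] M0
      by (simp add: carrier_integer_mod_group)
  qed
qed


section \<open>Arithmetic of moduli\<close>

text \<open>The number \<open>M\<close> is chosen so that \<open>e\<close> has additive order exactly \<open>a\<close>
modulo \<open>M\<close>, with no primes in \<open>M\<close> beyond those of \<open>a\<close>; the latter keeps
the cyclic group of order \<open>M\<close> in a class that is only known to contain the primes of
\<open>a\<close>. If \<open>a\<close> and \<open>e\<close> are coprime, \<open>M = a\<close> does; a common
factor of \<open>a\<close> and \<open>e\<close> is divided out of \<open>e\<close> and multiplied onto
\<open>M\<close>, which does not affect the divisibility.\<close>

lemma exists_modulus:
  fixes a e :: nat
  assumes "a > 0" "e > 0"
  obtains M where "M > 0" "\<And>p. prime p \<Longrightarrow> p dvd M \<Longrightarrow> p dvd a" "\<And>i. M dvd e * i \<longleftrightarrow> a dvd i"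
proof -
  have "\<exists>M>0. (\<forall>p. prime p \<longrightarrow> p dvd M \<longrightarrow> p dvd a) \<and> (\<forall>i. M dvd e * i \<longleftrightarrow> a dvd i)"
    using assms(2)
  proof (induction e rule: less_induct)
    case (less e)
    show ?case
    proof (cases "coprime a e")
      case True
      then show ?thesis using assms(1) by (intro exI[of _ a]) (simp add: coprime_dvd_mult_right_iff)
    next
      case False
      define d where "d = gcd a e"
      have d: "d > 1" "d dvd a" using False assms(1) by (auto simp: d_def coprime_iff_gcd_eq_1 nat_neq_iff)
      obtain e' where e': "e = d * e'" unfolding d_def by (metis dvdE gcd_dvd2)
      with less.prems d have "e' > 0" "e' < e" by auto
      then obtain M where "M > 0" "\<forall>p. prime p \<longrightarrow> p dvd M \<longrightarrow> p dvd a" "\<forall>i. M dvd e' * i \<longleftrightarrow> a dvd i"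
        using less.IH by blast
      with d e' show ?thesis
        by (intro exI[of _ "d * M"]) (simp add: prime_dvd_mult_iff mult.assoc, meson dvd_trans)
    qed
  qed
  with that show ?thesis by blast
qed

lemma card_multiples_below:
  fixes r n :: nat
  assumes "r > 0"
  shows "card {j. j < n * r \<and> r dvd j} = n"
proof -
  have "{j. j < n * r \<and> r dvd j} = (\<lambda>i. r * i) ` {..<n}"
    using assms by (auto simp: mult.commute image_iff elim!: dvdE)
  then show ?thesis using assms by (simp add: card_image inj_on_def)
qed


section \<open>Cosets and congruences\<close>

lemma (in group) r_coset_eq_iff:
  assumes "subgroup N G" "g \<in> carrier G" "h \<in> carrier G"
  shows "N #> g = N #> h \<longleftrightarrow> g \<otimes> inv h \<in> N"
proof
  assume "N #> g = N #> h"
  then have "g \<in> N #> h" using rcos_self[OF assms(2,1)] by simp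
  then obtain n where n: "n \<in> N" "g = n \<otimes> h" unfolding r_coset_def by blast
  then show "g \<otimes> inv h \<in> N"
    using subgroup.mem_carrier[OF assms(1) n(1)] assms(3) by (simp add: m_assoc)
next
  assume n: "g \<otimes> inv h \<in> N"
  have "g = (g \<otimes> inv h) \<otimes> h" using assms by (simp add: m_assoc)
  then have "g \<in> N #> h" using n unfolding r_coset_def by blast
  then show "N #> g = N #> h"
    using repr_independence[OF _ assms(3,1)] by simp
qed

lemma (in group) coset_mult:
  assumes "N \<lhd> G" "g \<in> carrier G" "h \<in> carrier G" "g' \<in> carrier G" "h' \<in> carrier G"
    "N #> g = N #> g'" "N #> h = N #> h'"
  shows "N #> (g \<otimes> h) = N #> (g' \<otimes> h')"
  using normal.rcos_sum[OF assms(1,2,3)] normal.rcos_sum[OF assms(1,4,5)] assms(6,7) by simp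

lemma (in group) coset_inv:
  assumes "N \<lhd> G" "g \<in> carrier G" "h \<in> carrier G" "N #> g = N #> h"
  shows "N #> inv g = N #> inv h"
  using normal.rcos_inv[OF assms(1,2)] normal.rcos_inv[OF assms(1,3)] assms(4) by simp

lemma (in group) coset_commute_pow:
  assumes N: "N \<lhd> G" and g: "g \<in> carrier G" and h: "h \<in> carrier G"
    and comm: "N #> (g \<otimes> h) = N #> (h \<otimes> g)"
  shows "N #> (g \<otimes> h [^] (j::nat)) = N #> (h [^] j \<otimes> g)"
proof -
  interpret Q: group "G Mod N" using normal.factorgroup_is_group[OF N] .
  have c: "N #> g \<in> carrier (G Mod N)" "N #> h \<in> carrier (G Mod N)"
    using g h by (auto simp: carrier_FactGroup)
  have "(N #> g) <#> (N #> h) = (N #> h) <#> (N #> g)"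
    using normal.rcos_sum[OF N] g h comm by simp
  then have "(N #> h) [^]\<^bsub>G Mod N\<^esub> j <#> (N #> g) = (N #> g) <#> (N #> h) [^]\<^bsub>G Mod N\<^esub> j"
    using Q.group_commutes_pow[of "N #> h" "N #> g" j] c by simp
  then show ?thesis
    using normal.rcos_sum[OF N] normal.FactGroup_pow[OF N h] g h by simp
qed

lemma (in group) coset_commute_inv:
  assumes N: "N \<lhd> G" and g: "g \<in> carrier G" and h: "h \<in> carrier G"
    and comm: "N #> (g \<otimes> inv h) = N #> (inv h \<otimes> g)"
  shows "N #> (g \<otimes> h) = N #> (h \<otimes> g)"
proof -
  have "N #> (h \<otimes> (g \<otimes> inv h)) = N #> (h \<otimes> (inv h \<otimes> g))"
    by (rule coset_mult[OF N _ _ _ _ refl comm]) (simp_all add: g h)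
  then have "N #> (h \<otimes> (g \<otimes> inv h) \<otimes> h) = N #> (h \<otimes> (inv h \<otimes> g) \<otimes> h)"
    by (rule coset_mult[OF N _ _ _ _ _ refl, rotated 4]) (simp_all add: g h)
  moreover have "h \<otimes> (inv h \<otimes> g) = g" using g h by (simp add: m_assoc[symmetric])
  ultimately show ?thesis using g h by (simp add: m_assoc)
qed

lemma (in group) exists_transversal:
  obtains t where "\<And>k. k \<in> carrier G \<Longrightarrow> t k \<in> carrier G" "\<And>k. k \<in> carrier G \<Longrightarrow> U #> t k = U #> k"
    "\<And>k k'. U #> k = U #> k' \<Longrightarrow> t k = t k'"
proof -
  define t where "t = (\<lambda>k. SOME r. r \<in> carrier G \<and> U #> r = U #> k)"
  have t: "t k \<in> carrier G \<and> U #> t k = U #> k" if "k \<in> carrier G" for k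
    unfolding t_def by (rule someI[of _ k]) (simp add: that)
  show ?thesis
  proof (rule that[of t])
    show "t k \<in> carrier G" "U #> t k = U #> k" if "k \<in> carrier G" for k
      using t[OF that] by simp_all
    show "t k = t k'" if "U #> k = U #> k'" for k k'
      by (simp add: t_def that)
  qed
qed

lemma (in group) subset_coset_eq:
  assumes "subgroup V G" "subgroup U G" "V \<subseteq> U" "k \<in> carrier G" "k' \<in> carrier G" "V #> k = V #> k'"
  shows "U #> k = U #> k'"
  using r_coset_eq_iff[OF assms(1,4,5)] r_coset_eq_iff[OF assms(2,4,5)] assms(3,6) by auto

lemma (in comm_group) cancel_swap:
  assumes "y \<in> carrier G" "z \<in> carrier G" "x \<in> carrier G" "x \<otimes> y = y \<otimes> z"
  shows "x = z"
  using right_cancel[of y x z] m_comm[of y z] assms by metis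

lemma (in group) generate_subset_centralizer_pow:
  assumes "a \<in> carrier G"
  shows "generate G {a} \<subseteq> centralizer G (a [^] (n::int))"
proof
  fix g assume "g \<in> generate G {a}"
  then obtain k :: int where "g = a [^] k" using generate_pow[OF assms] by auto
  then show "g \<in> centralizer G (a [^] n)"
    using assms by (simp add: centralizer_def add.commute flip: int_pow_mult)
qed


section \<open>Topology of profinite groups in terms of cosets\<close>

locale profinite = group G for G :: "('a, 'b) monoid_scheme" (structure) +
  fixes T :: "'a topology"
  assumes profinite: "profinite_group G T"
begin

lemma topspace_eq: "topspace T = carrier G"
  and mult_continuous: "continuous_map (prod_topology T T) T (\<lambda>(x, y). x \<otimes> y)"
  using profinite unfolding profinite_group_def topological_group_def by meson+

lemma small_open_normal:
  assumes "openin T U" "\<one> \<in> U"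
  obtains N where "open_normal G T N" "N \<subseteq> U"
  using profinite assms unfolding profinite_group_def by meson

lemma open_normalD:
  assumes "open_normal G T N"
  shows "N \<lhd> G" "subgroup N G" "openin T N" "N \<subseteq> carrier G"
  using assms normal_imp_subgroup[of N G] subgroup.subset[of N G] by (auto simp: open_normal_def)

lemma openin_translate:
  assumes U: "openin T U" and g: "g \<in> carrier G"
  shows "openin T {h \<in> carrier G. h \<otimes> g \<in> U}"
proof -
  have "continuous_map T (prod_topology T T) (\<lambda>h. (h, g))"
    by (intro continuous_map_pairedI) (simp_all add: topspace_eq g)
  then have "continuous_map T T ((\<lambda>(x, y). x \<otimes> y) \<circ> (\<lambda>h. (h, g)))"
    using mult_continuous by (rule continuous_map_compose)
  from openin_continuous_map_preimage[OF this U] show ?thesis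
    by (simp add: topspace_eq)
qed

lemma openin_coset:
  assumes N: "open_normal G T N" and g: "g \<in> carrier G"
  shows "openin T {h \<in> carrier G. N #> h = N #> g}"
proof -
  have "{h \<in> carrier G. N #> h = N #> g} = {h \<in> carrier G. h \<otimes> inv g \<in> N}"
    using r_coset_eq_iff[OF open_normalD(2)[OF N]] g by auto
  then show ?thesis using openin_translate[OF open_normalD(3)[OF N]] g by simp
qed

text \<open>The cosets of the open normal subgroups form a base of the topology. Together with the next lemma this turns
topological statements into congruences modulo open normal subgroups.\<close>

lemma openin_iff_cosets:
  "openin T U \<longleftrightarrow> U \<subseteq> carrier G \<and>
     (\<forall>g\<in>U. \<exists>N. open_normal G T N \<and> (\<forall>h\<in>carrier G. N #> h = N #> g \<longrightarrow> h \<in> U))"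
    (is "?L \<longleftrightarrow> ?R")
proof
  assume U: ?L
  then have sU: "U \<subseteq> carrier G" using openin_subset topspace_eq by auto
  have "\<exists>N. open_normal G T N \<and> (\<forall>h\<in>carrier G. N #> h = N #> g \<longrightarrow> h \<in> U)" if g: "g \<in> U" for g
  proof -
    have gc: "g \<in> carrier G" using g sU by auto
    obtain N where N: "open_normal G T N" "N \<subseteq> {h \<in> carrier G. h \<otimes> g \<in> U}"
      by (rule small_open_normal[OF openin_translate[OF U gc]]) (simp_all add: gc g)
    have "h \<in> U" if h: "h \<in> carrier G" "N #> h = N #> g" for h
    proof -
      have "h \<otimes> inv g \<in> N" using h gc r_coset_eq_iff[OF open_normalD(2)[OF N(1)]] by simp
      then have "h \<otimes> inv g \<otimes> g \<in> U" using N(2) by auto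
      then show ?thesis using h gc by (simp add: m_assoc)
    qed
    with N(1) show ?thesis by blast
  qed
  with sU show ?R by simp
next
  assume R: ?R
  show ?L
  proof (subst openin_subopen, intro ballI)
    fix g assume g: "g \<in> U"
    then obtain N where N: "open_normal G T N" "\<forall>h\<in>carrier G. N #> h = N #> g \<longrightarrow> h \<in> U"
      using R by meson
    have gc: "g \<in> carrier G" using R g by auto
    have "openin T {h \<in> carrier G. N #> h = N #> g}" by (rule openin_coset[OF N(1) gc])
    moreover have "{h \<in> carrier G. N #> h = N #> g} \<subseteq> U" using N(2) by auto
    ultimately show "\<exists>S. openin T S \<and> g \<in> S \<and> S \<subseteq> U" using gc by auto
  qed
qed

lemma in_closure_iff_cosets:
  assumes S: "S \<subseteq> carrier G"
  shows "g \<in> T closure_of S \<longleftrightarrow>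
    g \<in> carrier G \<and> (\<forall>N. open_normal G T N \<longrightarrow> (\<exists>s\<in>S. N #> s = N #> g))"
    (is "?L \<longleftrightarrow> ?R")
proof
  assume L: ?L
  then have g: "g \<in> carrier G" by (simp add: in_closure_of topspace_eq)
  have "\<exists>s\<in>S. N #> s = N #> g" if N: "open_normal G T N" for N
  proof -
    have "g \<in> {h \<in> carrier G. N #> h = N #> g} \<and> openin T {h \<in> carrier G. N #> h = N #> g}"
      using openin_coset[OF N g] g by simp
    then have "\<exists>y. y \<in> S \<and> y \<in> {h \<in> carrier G. N #> h = N #> g}"
      using L unfolding in_closure_of by meson
    then show ?thesis by auto
  qed
  with g show ?R by simp
next
  assume R: ?R
  show ?L
    unfolding in_closure_of topspace_eq
  proof (intro conjI allI impI)
    fix U assume U: "g \<in> U \<and> openin T U"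
    then obtain N where N: "open_normal G T N" "\<forall>h\<in>carrier G. N #> h = N #> g \<longrightarrow> h \<in> U"
      unfolding openin_iff_cosets by meson
    then obtain s where "s \<in> S" "N #> s = N #> g" using R by meson
    then show "\<exists>y. y \<in> S \<and> y \<in> U" using N(2) S by auto
  qed (use R in simp)
qed

lemma closure_subgroup:
  assumes S: "subgroup S G"
  shows "subgroup (T closure_of S) G"
proof (rule subgroupI)
  note iff = in_closure_iff_cosets[OF subgroup.subset[OF S]]
  note Sc = subgroup.mem_carrier[OF S]
  show "T closure_of S \<subseteq> carrier G" using iff by auto
  have "S \<subseteq> T closure_of S"
    by (simp add: closure_of_subset subgroup.subset[OF S] topspace_eq)
  then show "T closure_of S \<noteq> {}" using subgroup.one_closed[OF S] by auto
  show "inv g \<in> T closure_of S" if g: "g \<in> T closure_of S" for g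
    unfolding iff
  proof (intro conjI allI impI)
    show "inv g \<in> carrier G" using g iff by simp
    fix N assume N: "open_normal G T N"
    then obtain s where s: "s \<in> S" "N #> s = N #> g" using g iff by meson
    then have "N #> inv s = N #> inv g"
      using coset_inv[OF open_normalD(1)[OF N]] g iff Sc by simp
    then show "\<exists>s\<in>S. N #> s = N #> inv g"
      using subgroup.m_inv_closed[OF S s(1)] by auto
  qed
  show "g \<otimes> h \<in> T closure_of S" if gh: "g \<in> T closure_of S" "h \<in> T closure_of S" for g h
    unfolding iff
  proof (intro conjI allI impI)
    show "g \<otimes> h \<in> carrier G" using gh iff by simp
    fix N assume N: "open_normal G T N"
    then obtain s t where s: "s \<in> S" "N #> s = N #> g" "t \<in> S" "N #> t = N #> h"
      using gh iff by meson
    then have "N #> (s \<otimes> t) = N #> (g \<otimes> h)"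
      using coset_mult[OF open_normalD(1)[OF N]] gh iff Sc by simp
    then show "\<exists>s\<in>S. N #> s = N #> (g \<otimes> h)"
      using subgroup.m_closed[OF S s(1,3)] by auto
  qed
qed

lemma closure_normal:
  assumes S: "S \<lhd> G"
  shows "T closure_of S \<lhd> G"
  unfolding normal_inv_iff
proof (intro conjI ballI)
  have sub: "subgroup S G" using S by (rule normal_imp_subgroup)
  note iff = in_closure_iff_cosets[OF subgroup.subset[OF sub]]
  show "subgroup (T closure_of S) G" by (rule closure_subgroup[OF sub])
  fix x g assume x: "x \<in> carrier G" and g: "g \<in> T closure_of S"
  show "x \<otimes> g \<otimes> inv x \<in> T closure_of S"
    unfolding iff
  proof (intro conjI allI impI)
    show "x \<otimes> g \<otimes> inv x \<in> carrier G" using x g iff by simp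
    fix N assume N: "open_normal G T N"
    then obtain s where s: "s \<in> S" "N #> s = N #> g" using g iff by meson
    have "s \<in> carrier G" "g \<in> carrier G" using subgroup.mem_carrier[OF sub s(1)] g iff by auto
    with s(2) x have "N #> (x \<otimes> s \<otimes> inv x) = N #> (x \<otimes> g \<otimes> inv x)"
      by (intro coset_mult[OF open_normalD(1)[OF N]]) simp_all
    moreover have "x \<otimes> s \<otimes> inv x \<in> S" using normal.inv_op_closed2[OF S x s(1)] .
    ultimately show "\<exists>s\<in>S. N #> s = N #> (x \<otimes> g \<otimes> inv x)" by auto
  qed
qed

lemma closure_subset_open_subgroup:
  assumes P: "subgroup P G" and N: "open_normal G T N" "N \<subseteq> P" and S: "S \<subseteq> P"
  shows "T closure_of S \<subseteq> P"
proof
  fix g assume "g \<in> T closure_of S"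
  moreover have Sc: "S \<subseteq> carrier G" using S subgroup.subset[OF P] by auto
  ultimately obtain s where g: "g \<in> carrier G" and s: "s \<in> S" "N #> s = N #> g"
    using in_closure_iff_cosets[OF Sc] N(1) by meson
  have sc: "s \<in> carrier G" using s Sc by auto
  have "g \<otimes> inv s \<in> N"
    using r_coset_eq_iff[OF open_normalD(2)[OF N(1)] g sc] s(2) by simp
  then have "g \<otimes> inv s \<otimes> s \<in> P"
    using N(2) S s(1) subgroup.m_closed[OF P] by auto
  then show "g \<in> P" using g sc by (simp add: m_assoc)
qed

lemma open_normal_superset:
  assumes U: "U \<lhd> G" and N: "open_normal G T N" "N \<subseteq> U"
  shows "open_normal G T U"
proof -
  have "openin T U"
  proof (subst openin_iff_cosets, intro conjI ballI)
  have sub: "subgroup U G" using U by (rule normal_imp_subgroup)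
  show "U \<subseteq> carrier G" using sub by (rule subgroup.subset)
  fix g assume g: "g \<in> U"
  have "h \<in> U" if h: "h \<in> carrier G" "N #> h = N #> g" for h
  proof -
    have gc: "g \<in> carrier G" using subgroup.mem_carrier[OF sub g] .
    have "h \<otimes> inv g \<in> N"
      using r_coset_eq_iff[OF open_normalD(2)[OF N(1)] h(1) gc] h(2) by simp
    then have "h \<otimes> inv g \<otimes> g \<in> U" using N(2) g subgroup.m_closed[OF sub] by auto
    then show ?thesis using h(1) gc by (simp add: m_assoc)
  qed
  with N(1) show "\<exists>N. open_normal G T N \<and> (\<forall>h\<in>carrier G. N #> h = N #> g \<longrightarrow> h \<in> U)" by auto
  qed
  with U show ?thesis by (simp add: open_normal_def)
qed

lemma open_normal_Int:
  assumes "open_normal G T M" "open_normal G T N"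
  shows "open_normal G T (M \<inter> N)"
  unfolding open_normal_def
  using normal_inv_iff subgroups_Inter_pair open_normalD[OF assms(1)] open_normalD[OF assms(2)]
  by (simp add: openin_Int)

lemma closed_derived_normal: "closed_derived G T i \<lhd> G"
proof (induction i)
  case 0
  show ?case by (simp add: normal_self)
next
  case (Suc i)
  then have "derived G (closed_derived G T i) \<lhd> G" by (rule derived_is_normal)
  then show ?case
    using closure_normal by (simp add: top_generated_def derived_def)
qed

lemma closedin_closed_derived: "closedin T (closed_derived G T i)"
  by (cases i) (simp_all add: top_generated_def closedin_closure_of flip: topspace_eq)

lemma closed_derived_mono: "closed_derived G T (Suc i) \<subseteq> closed_derived G T i"
proof (induction i)
  case 0
  show ?case using closed_derived_normal[of "Suc 0"] normal_imp_subgroup subgroup.subset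
    by (metis closed_derived.simps(1))
next
  case (Suc i)
  have "derived_set G (closed_derived G T (Suc i)) \<subseteq> derived_set G (closed_derived G T i)"
    using Suc by blast
  then show ?case
    unfolding closed_derived.simps(2)[of G T "Suc i"]
    by (subst closed_derived.simps(2)) (simp add: top_generated_def closure_of_mono mono_generate)
qed

lemma closed_derived_antimono:
  "i \<le> j \<Longrightarrow> closed_derived G T j \<subseteq> closed_derived G T i"
  using lift_Suc_antimono_le[of "closed_derived G T"] closed_derived_mono by blast

text \<open>Open subgroups are closed, so for containment in an open subgroup the closure in the definition of the series
can be ignored.\<close>

lemma closed_derived_Suc_subset:
  assumes P: "subgroup P G" and N: "open_normal G T N" "N \<subseteq> P"
    and comm: "\<And>g h. g \<in> closed_derived G T i \<Longrightarrow> h \<in> closed_derived G T i \<Longrightarrow>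
      g \<otimes> h \<otimes> inv g \<otimes> inv h \<in> P"
  shows "closed_derived G T (Suc i) \<subseteq> P"
proof -
  have "generate G (derived_set G (closed_derived G T i)) \<subseteq> P"
    using comm by (intro generate_subgroup_incl[OF _ P]) auto
  then show ?thesis
    using closure_subset_open_subgroup[OF P N] by (simp add: top_generated_def)
qed

lemma commutator_in_closed_derived:
  assumes "g \<in> closed_derived G T i" "h \<in> closed_derived G T i"
  shows "g \<otimes> h \<otimes> inv g \<otimes> inv h \<in> closed_derived G T (Suc i)"
proof -
  have sub: "derived_set G (closed_derived G T i) \<subseteq> carrier G"
    using closed_derived_normal[THEN normal_imp_subgroup, THEN subgroup.mem_carrier] by auto
  have "generate G (derived_set G (closed_derived G T i)) \<subseteq> closed_derived G T (Suc i)"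
    using generate_incl[OF sub] by (simp add: top_generated_def closure_of_subset topspace_eq)
  then show ?thesis using assms generate.incl[of _ "derived_set G (closed_derived G T i)" G] by blast
qed

end


section \<open>Homomorphisms from a free pro-C group to finite groups\<close>

lemma pro_C_group_discrete:
  fixes K (structure)
  assumes C: "full_class C" and K: "in_class C K"
  shows "pro_C_group C K (discrete_topology (carrier K))"
proof -
  interpret group K using in_class_group[OF K] .
  have "\<exists>N. open_normal K (discrete_topology (carrier K)) N \<and> N \<subseteq> U"
    if U: "openin (discrete_topology (carrier K)) U \<and> \<one> \<in> U" for U
    using U one_is_normal by (intro exI[of _ "{\<one>}"]) (auto simp: open_normal_def)
  moreover have "topological_group K (discrete_topology (carrier K))"
    unfolding topological_group_def
    by (auto simp: is_group simp flip: prod_topology_discrete_topology)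
  moreover have "in_class C (K Mod N)" if "open_normal K (discrete_topology (carrier K)) N" for N
    using in_class_quotient[OF C K] that by (simp add: open_normal_def)
  ultimately show ?thesis
    using in_class_finite[OF C K]
    by (simp add: pro_C_group_def profinite_group_def compact_space_discrete_topology)
qed

locale free_pro_C =
  fixes C :: "nat monoid set" and F :: "'a monoid" (structure) and T :: "'a topology" and B :: "'a set"
  assumes full: "full_class C" and nonempty: "C \<noteq> {}" and free: "free_pro_C_group C F T B"

sublocale free_pro_C \<subseteq> profinite F T
proof -
  have *: "profinite_group F T"
    using free by (simp_all only: free_pro_C_group_def pro_C_group_def)
  then have "group F" by (simp_all only: profinite_group_def topological_group_def)
  with * show "profinite F T" by (simp_all only: profinite_def profinite_axioms_def)
qed

context free_pro_C
begin

lemma basis_subset: "B \<subseteq> carrier F"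
  and basis_dense: "T closure_of (generate F B) = carrier F"
  using free by (simp_all only: free_pro_C_group_def top_generated_def)

lemma basis_converges: "open_normal F T N \<Longrightarrow> finite {x \<in> B. x \<notin> N}"
  using free by (simp_all only: free_pro_C_group_def converges_to_one_def)

lemma in_class_Mod:
  assumes "open_normal F T N"
  shows "in_class C (F Mod N)"
proof -
  have "pro_C_group C F T" using free by (simp_all only: free_pro_C_group_def)
  then show ?thesis using assms by (simp_all only: pro_C_group_def)
qed

lemma finite_Mod: "open_normal F T N \<Longrightarrow> finite (carrier (F Mod N))"
  using in_class_finite[OF full in_class_Mod] .

text \<open>An open subgroup containing the basis is both closed and dense. The lemma is applied to the set where two maps
agree, which makes continuous maps to finite groups determined by their values on the basis.\<close>

lemma open_subgroup_basis:
  assumes "subgroup P F" "B \<subseteq> P" "open_normal F T N" "N \<subseteq> P"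
  shows "P = carrier F"
proof -
  have "generate F B \<subseteq> P" using assms(2,1) by (rule generate_subgroup_incl)
  then have "T closure_of (generate F B) \<subseteq> P"
    using closure_subset_open_subgroup assms by blast
  then show ?thesis using basis_dense subgroup.subset[OF assms(1)] by auto
qed

text \<open>The universal property asks for maps whose image generates the target, so the target is cut
  down to the subgroup generated by the image.\<close>

lemma extend_to_finite:
  assumes K: "in_class C K" and \<phi>: "\<phi> \<in> B \<rightarrow> carrier K" and fin: "finite {y \<in> B. \<phi> y \<noteq> \<one>\<^bsub>K\<^esub>}"
  obtains \<psi> where "\<psi> \<in> hom F K" "\<And>y. y \<in> B \<Longrightarrow> \<psi> y = \<phi> y" "open_normal F T (kernel F K \<psi>)"
proof -
  interpret K: group K using in_class_group[OF K] .
  let ?H = "generate K (\<phi> ` B)"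
  have imK: "\<phi> ` B \<subseteq> carrier K" using \<phi> by auto
  have sub: "subgroup ?H K" using K.generate_is_subgroup[OF imK] .
  let ?K = "K\<lparr>carrier := ?H\<rparr>"
  let ?S = "discrete_topology ?H"
  have pro: "pro_C_group C ?K ?S"
    using pro_C_group_discrete[OF full in_class_subgroup[OF full K sub]] by simp
  have "\<phi> ` B \<subseteq> ?H" using generate.incl[of _ "\<phi> ` B" K] by auto
  then have 1: "\<phi> \<in> B \<rightarrow> carrier ?K" by auto
  have 2: "converges_to_one B \<phi> ?K ?S"
    unfolding converges_to_one_def
  proof (intro allI impI)
    fix N assume "open_normal ?K ?S N"
    then have "\<one>\<^bsub>K\<^esub> \<in> N"
      using normal_imp_subgroup[of N ?K] subgroup.one_closed[of N ?K] by (simp add: open_normal_def)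
    then have "{y \<in> B. \<phi> y \<notin> N} \<subseteq> {y \<in> B. \<phi> y \<noteq> \<one>\<^bsub>K\<^esub>}" by auto
    then show "finite {y \<in> B. \<phi> y \<notin> N}" using fin by (rule finite_subset)
  qed
  have "generate ?K (\<phi> ` B) = ?H"
    using K.generate_consistent[OF _ sub] \<open>\<phi> ` B \<subseteq> ?H\<close> by simp
  then have 3: "top_generated ?K ?S (\<phi> ` B) = carrier ?K"
    using closure_of_topspace[of ?S] by (simp add: top_generated_def)
  have ext: "extension_property F T B ?K ?S" using free_pro_C_group_extension[OF free pro] .
  have "\<exists>!\<psi>. \<psi> \<in> extensional (carrier F) \<and> \<psi> \<in> hom F ?K \<and> continuous_map T ?S \<psi> \<and> (\<forall>x\<in>B. \<psi> x = \<phi> x)"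
    by (rule mp[OF spec[OF ext[unfolded extension_property_def], of \<phi>]]) (intro conjI 1 2 3)
  then obtain \<psi> where \<psi>: "\<psi> \<in> hom F ?K" "continuous_map T ?S \<psi>" "\<forall>x\<in>B. \<psi> x = \<phi> x"
    by blast
  have h: "\<psi> \<in> hom F K"
    using \<psi>(1) subgroup.mem_carrier[OF sub] by (auto simp: hom_def)
  then interpret \<psi>: group_hom F K \<psi>
    by unfold_locales
  have "openin T {x \<in> topspace T. \<psi> x \<in> {\<one>\<^bsub>K\<^esub>}}"
    using \<psi>(2) subgroup.one_closed[OF sub] by (intro openin_continuous_map_preimage[OF \<psi>(2)]) simp
  then have "open_normal F T (kernel F K \<psi>)"
    using \<psi>.normal_kernel by (simp add: open_normal_def kernel_def topspace_eq)
  with h \<psi>(3) show ?thesis by (intro that[of \<psi>]) simp_all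
qed

end


section \<open>Wreath products and crossed maps\<close>

text \<open>The regular wreath product, with \<open>p\<close> acting on functions by right translation of the argument. With
this convention the first component \<open>d\<close> of a homomorphism, evaluated at the coset of
\<open>k\<close>, satisfies the rule \<open>d (w w') k = d w k \<cdot> d w' (k w)\<close>, without
any inverses.\<close>

definition wreath :: "('b, 'c) monoid_scheme \<Rightarrow> ('q, 'd) monoid_scheme \<Rightarrow> (('q \<Rightarrow> 'b) \<times> 'q) monoid" where
  "wreath A Q =
     \<lparr>carrier = (carrier Q \<rightarrow>\<^sub>E carrier A) \<times> carrier Q,
      mult = (\<lambda>(f, p) (g, q). (\<lambda>k\<in>carrier Q. f k \<otimes>\<^bsub>A\<^esub> g (k \<otimes>\<^bsub>Q\<^esub> p), p \<otimes>\<^bsub>Q\<^esub> q)),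
      one = (\<lambda>k\<in>carrier Q. \<one>\<^bsub>A\<^esub>, \<one>\<^bsub>Q\<^esub>)\<rparr>"

lemma wreath_group:
  assumes "group A" "group Q"
  shows "group (wreath A Q)"
proof -
  interpret A: group A by fact
  interpret Q: group Q by fact
  show ?thesis
  proof (rule groupI)
    fix u v assume "u \<in> carrier (wreath A Q)" "v \<in> carrier (wreath A Q)"
    then show "u \<otimes>\<^bsub>wreath A Q\<^esub> v \<in> carrier (wreath A Q)"
      by (auto simp: wreath_def PiE_iff split: prod.splits)
  next
    show "\<one>\<^bsub>wreath A Q\<^esub> \<in> carrier (wreath A Q)" by (simp add: wreath_def)
  next
    fix u v w assume "u \<in> carrier (wreath A Q)" "v \<in> carrier (wreath A Q)" "w \<in> carrier (wreath A Q)"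
    then show "u \<otimes>\<^bsub>wreath A Q\<^esub> v \<otimes>\<^bsub>wreath A Q\<^esub> w = u \<otimes>\<^bsub>wreath A Q\<^esub> (v \<otimes>\<^bsub>wreath A Q\<^esub> w)"
      by (auto simp: wreath_def PiE_iff A.m_assoc Q.m_assoc intro!: restrict_ext split: prod.splits)
  next
    fix u assume "u \<in> carrier (wreath A Q)"
    then show "\<one>\<^bsub>wreath A Q\<^esub> \<otimes>\<^bsub>wreath A Q\<^esub> u = u"
      by (auto simp: wreath_def PiE_iff extensional_def restrict_def fun_eq_iff split: prod.splits)
  next
    fix u assume u: "u \<in> carrier (wreath A Q)"
    obtain f p where fp: "u = (f, p)" by (cases u)
    let ?v = "(\<lambda>k\<in>carrier Q. inv\<^bsub>A\<^esub> f (k \<otimes>\<^bsub>Q\<^esub> inv\<^bsub>Q\<^esub> p), inv\<^bsub>Q\<^esub> p)"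
    have "?v \<in> carrier (wreath A Q)"
      using u fp by (auto simp: wreath_def PiE_iff)
    moreover have "?v \<otimes>\<^bsub>wreath A Q\<^esub> u = \<one>\<^bsub>wreath A Q\<^esub>"
      using u fp by (auto simp: wreath_def PiE_iff intro!: restrict_ext)
    ultimately show "\<exists>v\<in>carrier (wreath A Q). v \<otimes>\<^bsub>wreath A Q\<^esub> u = \<one>\<^bsub>wreath A Q\<^esub>" by (rule bexI[rotated])
  qed
qed

lemma wreath_snd_hom: "snd \<in> hom (wreath A Q) Q"
  by (auto simp: hom_def wreath_def)

text \<open>The projection to \<open>Q\<close> has a power of \<open>A\<close> as its kernel, and the coordinates of that
power separate its points.\<close>

lemma in_class_wreath:
  assumes C: "full_class C" "C \<noteq> {}" and A: "in_class C A" and Q: "in_class C Q"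
  shows "in_class C (wreath A Q)"
proof -
  let ?W = "wreath A Q"
  have gA: "group A" and gQ: "group Q" using A Q in_class_group by auto
  have gW: "group ?W" using wreath_group[OF gA gQ] .
  have fA: "finite (carrier A)" and fQ: "finite (carrier Q)"
    using in_class_finite[OF C(1)] A Q by auto
  have fW: "finite (carrier ?W)"
    using fA fQ by (simp add: wreath_def finite_PiE)
  have snd: "snd \<in> hom ?W Q" by (rule wreath_snd_hom)
  interpret snd: group_hom ?W Q snd
    using gW gQ snd by (simp add: group_hom_def group_hom_axioms_def)
  have "in_class C (?W\<lparr>carrier := kernel ?W Q snd\<rparr>)"
  proof (rule in_class_residual[OF C fQ, where f = "\<lambda>k u. fst u k" and K = "\<lambda>_. A"])
    show "group (?W\<lparr>carrier := kernel ?W Q snd\<rparr>)"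
      using subgroup.subgroup_is_group[OF snd.subgroup_kernel gW] .
    show "finite (carrier (?W\<lparr>carrier := kernel ?W Q snd\<rparr>))"
      using finite_subset[OF subgroup.subset[OF snd.subgroup_kernel] fW] by simp
    show "(\<lambda>u. fst u k) \<in> hom (?W\<lparr>carrier := kernel ?W Q snd\<rparr>) A" if "k \<in> carrier Q" for k
      using that gQ by (auto simp: hom_def kernel_def wreath_def PiE_iff group.is_monoid)
    show "in_class C A" by (rule A)
    fix u assume u: "u \<in> carrier (?W\<lparr>carrier := kernel ?W Q snd\<rparr>)"
      and triv: "\<And>k. k \<in> carrier Q \<Longrightarrow> fst u k = \<one>\<^bsub>A\<^esub>"
    have "fst u = (\<lambda>k\<in>carrier Q. \<one>\<^bsub>A\<^esub>)"
    proof (rule extensionalityI[of _ "carrier Q"])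
      show "fst u \<in> extensional (carrier Q)"
        using u by (auto simp: kernel_def wreath_def PiE_iff)
    qed (simp_all add: triv)
    moreover have "snd u = \<one>\<^bsub>Q\<^esub>" using u by (simp add: kernel_def)
    ultimately show "u = \<one>\<^bsub>?W\<lparr>carrier := kernel ?W Q snd\<rparr>\<^esub>"
      by (simp add: wreath_def prod_eq_iff)
  qed
  then show ?thesis
    using in_class_extension[OF C(1) gW fW snd Q] by simp
qed

text \<open>The first components of homomorphisms into a wreath product, read as functions of two group elements. The rule
is the product rule of Fox derivatives, with \<open>w\<close> acting by right translation of \<open>k\<close>.\<close>

locale crossed_map = F: group F + A: comm_group A
  for F :: "('a, 'c) monoid_scheme" (structure) and A :: "('b, 'e) monoid_scheme" +
  fixes d :: "'a \<Rightarrow> 'a \<Rightarrow> 'b"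
  assumes closed [simp]: "w \<in> carrier F \<Longrightarrow> k \<in> carrier F \<Longrightarrow> d w k \<in> carrier A"
    and mult: "w \<in> carrier F \<Longrightarrow> w' \<in> carrier F \<Longrightarrow> k \<in> carrier F \<Longrightarrow>
      d (w \<otimes> w') k = d w k \<otimes>\<^bsub>A\<^esub> d w' (k \<otimes> w)"
begin

lemma one: "k \<in> carrier F \<Longrightarrow> d \<one> k = \<one>\<^bsub>A\<^esub>"
  using mult[of \<one> \<one> k] A.l_cancel_one'[of "d \<one> k" "d \<one> k"] by simp

lemma inv:
  assumes "w \<in> carrier F" "k \<in> carrier F"
  shows "d (inv w) k = inv\<^bsub>A\<^esub> d w (k \<otimes> inv w)"
proof -
  have "d w (k \<otimes> inv w) \<otimes>\<^bsub>A\<^esub> d (inv w) k = \<one>\<^bsub>A\<^esub>"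
    using mult[of w "inv w" "k \<otimes> inv w"] one assms by (simp add: F.m_assoc)
  then have "d (inv w) k \<otimes>\<^bsub>A\<^esub> d w (k \<otimes> inv w) = \<one>\<^bsub>A\<^esub>"
    using assms by (simp add: A.m_comm)
  then show ?thesis using A.inv_equality assms by simp
qed

end

context free_pro_C
begin

lemma hom_eq_if_eq_on_basis:
  assumes h: "group_hom F K h" "group_hom F K h'"
    and ker: "open_normal F T N" "N \<subseteq> kernel F K h" "N \<subseteq> kernel F K h'"
    and eq: "\<And>y. y \<in> B \<Longrightarrow> h y = h' y" and w: "w \<in> carrier F"
  shows "h w = h' w"
proof -
  interpret h: group_hom F K h by fact
  interpret h': group_hom F K h' by fact
  have 1: "subgroup {w \<in> carrier F. h w = h' w} F"
    by (rule subgroupI) (auto intro!: exI[of _ \<one>])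
  have 2: "B \<subseteq> {w \<in> carrier F. h w = h' w}" using eq basis_subset by auto
  have 3: "N \<subseteq> {w \<in> carrier F. h w = h' w}" using ker(2,3) by (auto simp: kernel_def subset_iff)
  show ?thesis using w open_subgroup_basis[OF 1 2 ker(1) 3] by blast
qed

lemma crossed_map_eq_if_eq_on_basis:
  assumes d: "crossed_map F A d" "crossed_map F A d'"
    and N: "open_normal F T N"
    and triv: "\<And>w k. w \<in> N \<Longrightarrow> k \<in> carrier F \<Longrightarrow> d w k = \<one>\<^bsub>A\<^esub>"
      "\<And>w k. w \<in> N \<Longrightarrow> k \<in> carrier F \<Longrightarrow> d' w k = \<one>\<^bsub>A\<^esub>"
    and eq: "\<And>y k. y \<in> B \<Longrightarrow> k \<in> carrier F \<Longrightarrow> d y k = d' y k"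
    and w: "w \<in> carrier F" and k: "k \<in> carrier F"
  shows "d w k = d' w k"
proof -
  interpret d: crossed_map F A d by fact
  interpret d': crossed_map F A d' by fact
  let ?P = "{w \<in> carrier F. \<forall>k\<in>carrier F. d w k = d' w k}"
  have 1: "subgroup ?P F"
  proof (rule subgroupI)
    show "?P \<noteq> {}" using d.one d'.one by (auto intro!: exI[of _ \<one>])
  qed (auto simp: d.inv d'.inv d.mult d'.mult)
  have 2: "B \<subseteq> ?P" using eq basis_subset by auto
  have 3: "N \<subseteq> ?P" using triv open_normalD(4)[OF N] by auto
  show ?thesis using w k open_subgroup_basis[OF 1 2 N 3] by blast
qed

text \<open>Values prescribed on the basis, together with the cosets of \<open>V\<close>, form a map from the basis to the
wreath product, which by the finiteness condition is trivial at almost all basis elements. The second component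
of the homomorphism extending it is the quotient map, because both have the same values on the basis; hence the
first component is a crossed map.\<close>

lemma exists_crossed_map:
  fixes A :: "('b, 'e) monoid_scheme"
  assumes V: "open_normal F T V" and A: "in_class C A" "comm_group A"
    and a: "\<And>y k. y \<in> B \<Longrightarrow> k \<in> carrier F \<Longrightarrow> a y k \<in> carrier A"
    and inv: "\<And>y k k'. y \<in> B \<Longrightarrow> k \<in> carrier F \<Longrightarrow> k' \<in> carrier F \<Longrightarrow> V #> k = V #> k' \<Longrightarrow> a y k = a y k'"
    and fin: "finite {y \<in> B. \<exists>k\<in>carrier F. a y k \<noteq> \<one>\<^bsub>A\<^esub>}"
  obtains d N where "crossed_map F A d"
    "\<And>w k k'. k \<in> carrier F \<Longrightarrow> k' \<in> carrier F \<Longrightarrow> V #> k = V #> k' \<Longrightarrow> d w k = d w k'"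
    "\<And>y k. y \<in> B \<Longrightarrow> k \<in> carrier F \<Longrightarrow> d y k = a y k"
    "open_normal F T N" "N \<subseteq> V" "\<And>w k. w \<in> N \<Longrightarrow> k \<in> carrier F \<Longrightarrow> d w k = \<one>\<^bsub>A\<^esub>"
proof -
  let ?Q = "F Mod V"
  let ?W = "wreath A ?Q"
  note Vn = open_normalD(1)[OF V] and Vs = open_normalD(2)[OF V]
  have gQ: "group ?Q" using normal.factorgroup_is_group[OF Vn] .
  have gW: "group ?W" using wreath_group[OF in_class_group[OF A(1)] gQ] .
  have cQ: "carrier ?Q = (\<lambda>k. V #> k) ` carrier F" by (rule carrier_FactGroup)
  define rep where "rep = (\<lambda>q. SOME k. k \<in> carrier F \<and> V #> k = q)"
  have rep: "rep q \<in> carrier F \<and> V #> rep q = q" if "q \<in> carrier ?Q" for q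
  proof -
    have "q \<in> (\<lambda>k. V #> k) ` carrier F" using that by (simp only: cQ)
    then obtain k where "q = V #> k" "k \<in> carrier F" by (rule imageE)
    then have "k \<in> carrier F \<and> V #> k = q" by simp
    then show ?thesis unfolding rep_def by (rule someI)
  qed
  define \<phi> where "\<phi> = (\<lambda>y. (\<lambda>q\<in>carrier ?Q. a y (rep q), V #> y))"
  have \<phi>: "\<phi> \<in> B \<rightarrow> carrier ?W"
  proof
    fix y assume y: "y \<in> B"
    have "a y (rep q) \<in> carrier A" if "q \<in> carrier ?Q" for q using a[OF y] rep[OF that] by simp
    moreover have "V #> y \<in> carrier ?Q" unfolding cQ using basis_subset y by (intro imageI) auto
    ultimately show "\<phi> y \<in> carrier ?W" by (simp add: \<phi>_def wreath_def)
  qed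
  have "{y \<in> B. \<phi> y \<noteq> \<one>\<^bsub>?W\<^esub>} \<subseteq> {y \<in> B. y \<notin> V} \<union> {y \<in> B. \<exists>k\<in>carrier F. a y k \<noteq> \<one>\<^bsub>A\<^esub>}"
  proof -
    have "\<phi> y = \<one>\<^bsub>?W\<^esub>" if y: "y \<in> B" "y \<in> V" "\<forall>k\<in>carrier F. a y k = \<one>\<^bsub>A\<^esub>" for y
    proof -
      have "V #> y = V" using coset_join2[OF _ Vs y(2)] basis_subset y(1) by auto
      moreover have "(\<lambda>q\<in>carrier ?Q. a y (rep q)) = (\<lambda>q\<in>carrier ?Q. \<one>\<^bsub>A\<^esub>)"
        using y(3) rep by (intro restrict_ext) simp
      ultimately show ?thesis by (simp add: \<phi>_def wreath_def)
    qed
    then show ?thesis by auto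
  qed
  then have "finite {y \<in> B. \<phi> y \<noteq> \<one>\<^bsub>?W\<^esub>}"
    using fin basis_converges[OF V] by (meson finite_UnI finite_subset)
  then obtain \<psi> where \<psi>: "\<psi> \<in> hom F ?W" "\<And>y. y \<in> B \<Longrightarrow> \<psi> y = \<phi> y"
      "open_normal F T (kernel F ?W \<psi>)"
    by (rule extend_to_finite[OF in_class_wreath[OF full nonempty A(1) in_class_Mod[OF V]] \<phi>])
       (rule that, simp_all)
  define N where "N = kernel F ?W \<psi> \<inter> V"
  have N: "open_normal F T N" unfolding N_def using open_normal_Int[OF \<psi>(3) V] .
  have snd: "snd (\<psi> w) = V #> w" if w: "w \<in> carrier F" for w
  proof -
    have "snd \<circ> \<psi> \<in> hom F ?Q"
      by (rule Group.hom_compose[OF \<psi>(1) wreath_snd_hom])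
    then have 1: "group_hom F ?Q (snd \<circ> \<psi>)"
      using gQ is_group by (simp add: group_hom_def group_hom_axioms_def)
    have 2: "group_hom F ?Q (\<lambda>k. V #> k)"
      using normal.r_coset_hom_Mod[OF Vn] gQ is_group by (simp add: group_hom_def group_hom_axioms_def)
    have 3: "N \<subseteq> kernel F ?Q (snd \<circ> \<psi>)" by (auto simp: N_def kernel_def wreath_def)
    have 4: "N \<subseteq> kernel F ?Q (\<lambda>k. V #> k)"
      using coset_join2[OF _ Vs] by (auto simp: N_def kernel_def)
    have "(snd \<circ> \<psi>) w = V #> w"
      by (rule hom_eq_if_eq_on_basis[OF 1 2 N 3 4 _ w]) (simp add: \<psi>(2) \<phi>_def)
    then show ?thesis by simp
  qed
  define d where "d = (\<lambda>w k. fst (\<psi> w) (V #> k))"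
  have ccl: "V #> k \<in> carrier ?Q" if "k \<in> carrier F" for k using that cQ by simp
  have \<psi>c: "fst (\<psi> w) \<in> carrier ?Q \<rightarrow>\<^sub>E carrier A" if "w \<in> carrier F" for w
    using hom_in_carrier[OF \<psi>(1) that] by (auto simp: wreath_def)
  show ?thesis
  proof (rule that)
    show "crossed_map F A d"
      unfolding crossed_map_def crossed_map_axioms_def
    proof (intro conjI allI impI is_group A(2))
      show "d w k \<in> carrier A" if "w \<in> carrier F" "k \<in> carrier F" for w k
        using \<psi>c[OF that(1)] ccl[OF that(2)] by (auto simp: d_def)
      fix w w' k assume w: "w \<in> carrier F" "w' \<in> carrier F" "k \<in> carrier F"
      have "V #> k <#> snd (\<psi> w) = V #> (k \<otimes> w)"
        using snd w normal.rcos_sum[OF Vn] by simp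
      moreover have "\<psi> (w \<otimes> w') = \<psi> w \<otimes>\<^bsub>?W\<^esub> \<psi> w'" using hom_mult[OF \<psi>(1) w(1,2)] .
      ultimately show "d (w \<otimes> w') k = d w k \<otimes>\<^bsub>A\<^esub> d w' (k \<otimes> w)"
        using ccl[OF w(3)] by (simp add: d_def wreath_def split_beta)
    qed
    show "d w k = d w k'" if "V #> k = V #> k'" for w k k'
      using that by (simp add: d_def)
    show "d y k = a y k" if y: "y \<in> B" "k \<in> carrier F" for y k
    proof -
      have "d y k = a y (rep (V #> k))" using y \<psi>(2) ccl by (simp add: d_def \<phi>_def)
      also have "\<dots> = a y k" using rep[OF ccl[OF y(2)]] y by (intro inv) auto
      finally show ?thesis .
    qed
    show "open_normal F T N" by (rule N)
    show "N \<subseteq> V" by (simp add: N_def)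
    show "d w k = \<one>\<^bsub>A\<^esub>" if "w \<in> N" "k \<in> carrier F" for w k
      using that ccl by (simp add: N_def kernel_def d_def wreath_def)
  qed
qed

end


section \<open>Crossed maps and the derived series\<close>

context free_pro_C
begin

lemma pow_mem_open_normal:
  assumes V: "open_normal F T V" and x: "x \<in> carrier F"
  obtains r where "r > 0" "\<And>j::nat. x [^] j \<in> V \<longleftrightarrow> r dvd j"
proof -
  note Vn = open_normalD(1)[OF V] and Vs = open_normalD(2)[OF V]
  interpret Q: group "F Mod V" using normal.factorgroup_is_group[OF Vn] .
  have c: "V #> x \<in> carrier (F Mod V)" using x by (auto simp: carrier_FactGroup)
  have "Q.ord (V #> x) > 0" using Q.ord_ge_1[OF finite_Mod[OF V] c] by simp
  moreover have "x [^] j \<in> V \<longleftrightarrow> Q.ord (V #> x) dvd j" for j :: nat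
  proof -
    have xj: "x [^] j \<in> carrier F" using x by simp
    have "x [^] j \<in> V \<longleftrightarrow> V #> (x [^] j) = V"
      using coset_join1[OF _ xj Vs] coset_join2[OF xj Vs] open_normalD(4)[OF V] by auto
    also have "\<dots> \<longleftrightarrow> (V #> x) [^]\<^bsub>F Mod V\<^esub> j = \<one>\<^bsub>F Mod V\<^esub>"
      using normal.FactGroup_pow[OF Vn x] by simp
    finally show ?thesis using Q.pow_eq_id[OF c] by simp
  qed
  ultimately show ?thesis using that by blast
qed

text \<open>Right translation by an element of \<open>V\<close> does not change the coset \<open>V k\<close>. For fixed
\<open>k\<close> the crossed map is therefore a homomorphism from \<open>V\<close> to an abelian group, and it
kills the commutators of elements of \<open>V\<close>.\<close>

lemma crossed_map_derived_trivial:
  assumes d: "crossed_map F A d" and N: "open_normal F T N" "N \<subseteq> V" and V: "V \<lhd> F"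
    and dV: "\<And>w k k'. k \<in> carrier F \<Longrightarrow> k' \<in> carrier F \<Longrightarrow> V #> k = V #> k' \<Longrightarrow> d w k = d w k'"
    and triv: "\<And>w k. w \<in> N \<Longrightarrow> k \<in> carrier F \<Longrightarrow> d w k = \<one>\<^bsub>A\<^esub>"
    and i: "closed_derived F T i \<subseteq> V"
    and w: "w \<in> closed_derived F T (Suc i)" and k: "k \<in> carrier F"
  shows "d w k = \<one>\<^bsub>A\<^esub>"
proof -
  interpret crossed_map F A d by fact
  note Vs = normal_imp_subgroup[OF V]
  note Vc = subgroup.mem_carrier[OF Vs]
  have shift: "d w (k \<otimes> v) = d w k" if "v \<in> V" "k \<in> carrier F" for w k v
  proof (rule dV)
    have "k \<otimes> v \<otimes> inv k \<in> V" using normal.inv_op_closed2[OF V that(2,1)] .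
    then show "V #> (k \<otimes> v) = V #> k"
      using r_coset_eq_iff[OF Vs] Vc that by simp
  qed (use that Vc in simp_all)
  let ?P = "{w \<in> V. \<forall>k\<in>carrier F. d w k = \<one>\<^bsub>A\<^esub>}"
  have "closed_derived F T (Suc i) \<subseteq> ?P"
  proof (rule closed_derived_Suc_subset[OF _ N(1)])
    show "subgroup ?P F"
    proof (rule subgroupI)
      show "?P \<subseteq> carrier F" using Vc by auto
      show "?P \<noteq> {}" using subgroup.one_closed[OF Vs] one by auto
      show "inv w \<in> ?P" if "w \<in> ?P" for w
        using that Vc subgroup.m_inv_closed[OF Vs] by (auto simp: crossed_map.inv[OF d])
      show "w \<otimes> w' \<in> ?P" if "w \<in> ?P" "w' \<in> ?P" for w w'
        using that Vc subgroup.m_closed[OF Vs] by (auto simp: mult)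
    qed
    show "N \<subseteq> ?P" using N(2) triv by auto
    fix g h assume "g \<in> closed_derived F T i" "h \<in> closed_derived F T i"
    then have g: "g \<in> V" "h \<in> V" using i by auto
    have "d (g \<otimes> h \<otimes> inv g \<otimes> inv h) k = \<one>\<^bsub>A\<^esub>" if k: "k \<in> carrier F" for k
    proof -
      have v: "u \<in> V \<Longrightarrow> v \<in> V \<Longrightarrow> d (u \<otimes> v) k = d u k \<otimes>\<^bsub>A\<^esub> d v k" for u v
        using mult[of u v k] shift[OF _ k] Vc k by simp
      have vi: "u \<in> V \<Longrightarrow> d (inv u) k = inv\<^bsub>A\<^esub> d u k" for u
        using crossed_map.inv[OF d, of u k] shift[OF _ k] subgroup.m_inv_closed[OF Vs] Vc k by simp
      have "d (g \<otimes> h \<otimes> inv g \<otimes> inv h) k = d g k \<otimes>\<^bsub>A\<^esub> d h k \<otimes>\<^bsub>A\<^esub> inv\<^bsub>A\<^esub> d g k \<otimes>\<^bsub>A\<^esub> inv\<^bsub>A\<^esub> d h k"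
        using g by (simp add: v vi subgroup.m_closed[OF Vs] subgroup.m_inv_closed[OF Vs])
      also have "\<dots> = \<one>\<^bsub>A\<^esub>"
        using closed[OF Vc[OF g(1)] k] closed[OF Vc[OF g(2)] k]
        by (metis A.m_comm A.inv_solve_right' A.m_closed A.inv_closed A.r_inv A.m_assoc A.l_one A.r_one)
      finally show ?thesis .
    qed
    then show "g \<otimes> h \<otimes> inv g \<otimes> inv h \<in> ?P"
      using g subgroup.m_closed[OF Vs] subgroup.m_inv_closed[OF Vs] by simp
  qed
  then show ?thesis using w k by auto
qed

text \<open>The last property is what commutation modulo the next derived subgroup means for the crossed map:
\<open>g u\<close> and \<open>u g\<close> differ by an element on which it is trivial, so they have the same
image, and both images expand by the product rule.\<close>

lemma exists_crossed_map_commute: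
  fixes A :: "('b, 'e) monoid_scheme"
  assumes V: "open_normal F T V" and A: "in_class C A" "comm_group A"
    and i: "closed_derived F T i \<subseteq> V"
    and a: "\<And>y k. y \<in> B \<Longrightarrow> k \<in> carrier F \<Longrightarrow> a y k \<in> carrier A"
    and aV: "\<And>y k k'. y \<in> B \<Longrightarrow> k \<in> carrier F \<Longrightarrow> k' \<in> carrier F \<Longrightarrow> V #> k = V #> k' \<Longrightarrow> a y k = a y k'"
    and fin: "finite {y \<in> B. \<exists>k\<in>carrier F. a y k \<noteq> \<one>\<^bsub>A\<^esub>}"
  obtains d N where "crossed_map F A d"
    "\<And>w k k'. k \<in> carrier F \<Longrightarrow> k' \<in> carrier F \<Longrightarrow> V #> k = V #> k' \<Longrightarrow> d w k = d w k'"
    "\<And>y k. y \<in> B \<Longrightarrow> k \<in> carrier F \<Longrightarrow> d y k = a y k"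
    "open_normal F T N" "\<And>w k. w \<in> N \<Longrightarrow> k \<in> carrier F \<Longrightarrow> d w k = \<one>\<^bsub>A\<^esub>"
    "\<And>g u k. g \<in> carrier F \<Longrightarrow> u \<in> carrier F \<Longrightarrow> k \<in> carrier F \<Longrightarrow>
       closed_derived F T (Suc i) #> (g \<otimes> u) = closed_derived F T (Suc i) #> (u \<otimes> g) \<Longrightarrow>
       d g k \<otimes>\<^bsub>A\<^esub> d u (k \<otimes> g) = d u k \<otimes>\<^bsub>A\<^esub> d g (k \<otimes> u)"
proof -
  obtain d N where d: "crossed_map F A d"
    and dV: "\<And>w k k'. k \<in> carrier F \<Longrightarrow> k' \<in> carrier F \<Longrightarrow> V #> k = V #> k' \<Longrightarrow> d w k = d w k'"
    and da: "\<And>y k. y \<in> B \<Longrightarrow> k \<in> carrier F \<Longrightarrow> d y k = a y k"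
    and N: "open_normal F T N" "N \<subseteq> V"
    and dN: "\<And>w k. w \<in> N \<Longrightarrow> k \<in> carrier F \<Longrightarrow> d w k = \<one>\<^bsub>A\<^esub>"
    using exists_crossed_map[where a = a, OF V A a aV fin] by blast
  interpret crossed_map F A d by (rule d)
  let ?D = "closed_derived F T (Suc i)"
  have Ds: "subgroup ?D F" using closed_derived_normal[of "Suc i"] by (rule normal_imp_subgroup)
  have Vn: "V \<lhd> F" and Vs: "subgroup V F" using open_normalD[OF V] by auto
  have DV: "?D \<subseteq> V" using i closed_derived_mono[of i] by blast
  have "d g k \<otimes>\<^bsub>A\<^esub> d u (k \<otimes> g) = d u k \<otimes>\<^bsub>A\<^esub> d g (k \<otimes> u)"
    if g: "g \<in> carrier F" and u: "u \<in> carrier F" and k: "k \<in> carrier F"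
      and eq: "?D #> (g \<otimes> u) = ?D #> (u \<otimes> g)" for g u k
  proof -
    define c where "c = (g \<otimes> u) \<otimes> inv (u \<otimes> g)"
    have c: "c \<in> ?D" unfolding c_def using r_coset_eq_iff[OF Ds] eq g u by simp
    have cF: "c \<in> carrier F" using subgroup.mem_carrier[OF Ds c] .
    have "k \<otimes> c \<otimes> inv k \<in> V" using normal.inv_op_closed2[OF Vn k] c DV by auto
    then have "V #> (k \<otimes> c) = V #> k" using r_coset_eq_iff[OF Vs] k cF by simp
    then have sh: "d (u \<otimes> g) (k \<otimes> c) = d (u \<otimes> g) k" using k cF by (intro dV) simp_all
    have "g \<otimes> u = c \<otimes> (u \<otimes> g)" unfolding c_def using g u by (simp add: m_assoc)
    then have "d (g \<otimes> u) k = d c k \<otimes>\<^bsub>A\<^esub> d (u \<otimes> g) (k \<otimes> c)"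
      using mult[of c "u \<otimes> g" k] cF g u k by simp
    also have "d c k = \<one>\<^bsub>A\<^esub>"
      using crossed_map_derived_trivial[OF d N Vn dV dN i c k] .
    finally have "d (g \<otimes> u) k = d (u \<otimes> g) k" using sh g u k by simp
    then show ?thesis using mult g u k by simp
  qed
  then show ?thesis using that d dV da N dN by blast
qed

text \<open>The crossed map used here is the Fox derivative with respect to \<open>x\<close>, followed by the coefficient of
the coset \<open>V\<close> and reduced modulo a number not dividing \<open>n\<close>. On powers of
\<open>x\<close> it counts visits to \<open>V\<close>. Commuting with \<open>g\<close> forces a power of
\<open>x\<close> to visit \<open>V\<close> from \<open>g\<close> as often as from \<open>1\<close>, up to a
multiple of the modulus.\<close>

lemma centralizer_of_power_mod_open_normal:
  assumes V: "open_normal F T V" and i: "closed_derived F T i \<subseteq> V"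
    and x: "x \<in> B" and n: "n > 0" and g: "g \<in> carrier F"
    and comm: "closed_derived F T (Suc i) #> (g \<otimes> x [^] (n::nat)) = closed_derived F T (Suc i) #> (x [^] n \<otimes> g)"
    and q: "prime q" "in_class C (integer_mod_group q)"
  shows "\<exists>j::int. V #> g = V #> x [^] j"
proof (rule ccontr)
  assume contra: "\<not> ?thesis"
  note Vs = open_normalD(2)[OF V]
  have xF: "x \<in> carrier F" using x basis_subset by (rule rev_subsetD)
  have q0: "q > 0" using q(1) prime_gt_0_nat by simp
  \<comment> \<open>Taking the index \<open>1\<close> in the last condition shows that \<open>M\<close> does not divide \<open>n\<close>.\<close>
  obtain M where M: "M > 0" "\<And>p. prime p \<Longrightarrow> p dvd M \<Longrightarrow> p dvd q" "\<And>i. M dvd n * i \<longleftrightarrow> q dvd i"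
    using exists_modulus[OF q0 n] by metis
  have nM: "\<not> M dvd n" using M(3)[of 1] q(1) not_prime_unit by auto
  then have M1: "M \<noteq> 1" by auto
  let ?A = "integer_mod_group M"
  have A: "in_class C ?A"
  proof (rule in_class_cyclic[OF full nonempty M(1)])
    fix p assume "prime p" "p dvd M"
    then have "p = q" using M(2) q(1) primes_dvd_imp_eq by metis
    then show "in_class C (integer_mod_group p)" using q(2) by simp
  qed
  define a where "a = (\<lambda>y k. if y = x \<and> k \<in> V then 1 else (0::int))"
  have a1: "\<And>y k. y \<in> B \<Longrightarrow> k \<in> carrier F \<Longrightarrow> a y k \<in> carrier ?A" using M1 by (simp add: a_def)
  have a2: "a y k = a y k'" if y: "y \<in> B" and k: "k \<in> carrier F" "k' \<in> carrier F" "V #> k = V #> k'" for y k k'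
  proof -
    have "k \<in> V \<longleftrightarrow> V #> k = V" "k' \<in> V \<longleftrightarrow> V #> k' = V"
      using k coset_join1[OF _ _ Vs] coset_join2[OF _ Vs] open_normalD(4)[OF V] by metis+
    then show ?thesis using k(3) by (simp add: a_def)
  qed
  have "{y \<in> B. \<exists>k\<in>carrier F. a y k \<noteq> \<one>\<^bsub>?A\<^esub>} \<subseteq> {x}" by (auto simp: a_def)
  then have a3: "finite {y \<in> B. \<exists>k\<in>carrier F. a y k \<noteq> \<one>\<^bsub>?A\<^esub>}" by (rule finite_subset) simp
  obtain d where d: "crossed_map F ?A d"
    and dV: "\<And>w k k'. k \<in> carrier F \<Longrightarrow> k' \<in> carrier F \<Longrightarrow> V #> k = V #> k' \<Longrightarrow> d w k = d w k'"
    and da: "\<And>y k. y \<in> B \<Longrightarrow> k \<in> carrier F \<Longrightarrow> d y k = a y k"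
    and dD: "\<And>g u k. g \<in> carrier F \<Longrightarrow> u \<in> carrier F \<Longrightarrow> k \<in> carrier F \<Longrightarrow>
       closed_derived F T (Suc i) #> (g \<otimes> u) = closed_derived F T (Suc i) #> (u \<otimes> g) \<Longrightarrow>
       d g k \<otimes>\<^bsub>?A\<^esub> d u (k \<otimes> g) = d u k \<otimes>\<^bsub>?A\<^esub> d g (k \<otimes> u)"
  proof (rule exists_crossed_map_commute[where a = a, OF V A abelian_integer_mod_group i], goal_cases)
    case (1 y k)
    show ?case by (rule a1[OF 1(2,3)])
  next
    case (2 y k k')
    show ?case by (rule a2[OF 2(2-5)])
  next
    case 3
    show ?case by (rule a3)
  next
    case (4 d N)
    show ?case by (rule that[OF 4(2,3,4,7)])
  qed
  have count: "d (x [^] m) k = int (card {j. j < m \<and> k \<otimes> x [^] j \<in> V}) mod int M"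
    if k: "k \<in> carrier F" for m :: nat and k
  proof (induction m)
    case 0
    then show ?case using crossed_map.one[OF d k] by simp
  next
    case (Suc m)
    have "{j. j < Suc m \<and> k \<otimes> x [^] j \<in> V} =
        (if k \<otimes> x [^] m \<in> V then insert m {j. j < m \<and> k \<otimes> x [^] j \<in> V} else {j. j < m \<and> k \<otimes> x [^] j \<in> V})"
      by (auto simp: less_Suc_eq)
    then have c: "int (card {j. j < Suc m \<and> k \<otimes> x [^] j \<in> V}) =
        int (card {j. j < m \<and> k \<otimes> x [^] j \<in> V}) + a x (k \<otimes> x [^] m)"
      by (simp add: a_def)
    have "d (x [^] Suc m) k = d (x [^] m) k \<otimes>\<^bsub>?A\<^esub> d x (k \<otimes> x [^] m)"
      using crossed_map.mult[OF d _ xF k, of "x [^] m"] xF by simp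
    then show ?case unfolding c using Suc da[OF x, of "k \<otimes> x [^] m"] k xF
      by (simp add: mod_simps)
  qed
  obtain r where r: "r > 0" "\<And>j::nat. x [^] j \<in> V \<longleftrightarrow> r dvd j"
    using pow_mem_open_normal[OF V xF] by metis
  \<comment> \<open>A power of \<open>x\<^sup>n\<close>, so that it commutes with \<open>g\<close>, and of \<open>x\<^sup>r\<close>, so that it lies in \<open>V\<close>.\<close>
  define w where "w = x [^] (n * r)"
  have wF: "w \<in> carrier F" using xF by (simp add: w_def)
  have wV: "w \<in> V" unfolding w_def r(2) by simp
  have "closed_derived F T (Suc i) #> (g \<otimes> w) = closed_derived F T (Suc i) #> (w \<otimes> g)"
    using coset_commute_pow[OF closed_derived_normal g _ comm, of r] xF by (simp add: w_def nat_pow_pow)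
  from dD[OF g wF one_closed this] have "(d g \<one> + d w g) mod int M = (d w \<one> + d g w) mod int M"
    using g wF by simp
  moreover have "d g w = d g \<one>"
    using coset_join2[OF wF Vs wV] open_normalD(4)[OF V] wF by (intro dV) simp_all
  ultimately have eq: "(d g \<one> + d w g) mod int M = (d w \<one> + d g \<one>) mod int M" by simp
  \<comment> \<open>Since no visit starts from \<open>g\<close>, the count at \<open>g\<close> is \<open>0\<close>, whereas the count at \<open>1\<close> is \<open>n\<close>.\<close>
  have "g \<otimes> x [^] j \<notin> V" for j :: nat
  proof
    assume "g \<otimes> x [^] j \<in> V"
    moreover have "x [^] j = inv (x [^] (- int j))"
      using xF by (simp add: int_pow_neg int_pow_int)
    ultimately have "V #> g = V #> x [^] (- int j)"
      using r_coset_eq_iff[OF Vs g, of "x [^] (- int j)"] xF by simp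
    then show False using contra by blast
  qed
  then have dwg: "d w g = 0" using count[OF g, of "n * r"] by (simp add: w_def)
  have "{j. j < n * r \<and> \<one> \<otimes> x [^] j \<in> V} = {j. j < n * r \<and> r dvd j}"
    using r(2) xF by simp
  then have dw1: "d w \<one> = int n mod int M"
    using count[OF one_closed, of "n * r"] card_multiples_below[OF r(1)] by (simp add: w_def)
  have "int M dvd int n"
    using eq unfolding dwg dw1 by (simp add: mod_simps mod_eq_dvd_iff)
  then show False using nM by simp
qed

end


section \<open>Transversals and their crossed maps\<close>

text \<open>The set \<open>R\<close> is a union of cosets of \<open>V\<close>, one in each coset of the subgroup generated
by \<open>z\<close> and \<open>V\<close>. As \<open>z\<close> has order \<open>c\<close> modulo
\<open>V\<close>, exactly one of \<open>k\<close>, \<open>z k\<close>, up to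
\<open>z\<^sup>c\<^sup>-\<^sup>1 k\<close>, lies in \<open>R\<close>. A function invariant under
\<open>z\<close> can thus be recovered by multiplying the translates of its restriction to \<open>R\<close>.\<close>

lemma (in group) exists_cyclic_transversal:
  assumes V: "V \<lhd> G" and z: "z \<in> carrier G" and c: "c > 0"
    and ord: "\<And>j::int. z [^] j \<in> V \<longleftrightarrow> int c dvd j"
  obtains R where "\<And>k k'. k \<in> carrier G \<Longrightarrow> k' \<in> carrier G \<Longrightarrow> V #> k = V #> k' \<Longrightarrow> k \<in> R \<longleftrightarrow> k' \<in> R"
    "\<And>k. k \<in> carrier G \<Longrightarrow> \<exists>l0<c. \<forall>l<c. z [^] (l::nat) \<otimes> k \<in> R \<longleftrightarrow> l = l0"
proof -
  have Vs: "subgroup V G" using V by (rule normal_imp_subgroup)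
  have zc: "z [^] j \<in> carrier G" for j :: int using z by simp
  have zeq: "V #> z [^] j = V #> z [^] l \<longleftrightarrow> int c dvd j - l" for j l :: int
    using r_coset_eq_iff[OF Vs zc zc] ord[of "j - l"] int_pow_diff[OF z, of j l] by simp
  define W where "W = {w \<in> carrier G. \<exists>l::int. V #> w = V #> z [^] l}"
  have Ws: "subgroup W G"
  proof (rule subgroupI)
    show "W \<subseteq> carrier G" by (auto simp: W_def)
    have "\<one> \<in> W" unfolding W_def by (auto intro!: exI[of _ "0::int"])
    then show "W \<noteq> {}" by auto
    show "inv w \<in> W" if "w \<in> W" for w
    proof -
      obtain l :: int where w: "w \<in> carrier G" "V #> w = V #> z [^] l" using \<open>w \<in> W\<close> by (auto simp: W_def)
      have "V #> inv w = V #> z [^] (- l)"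
        using normal.rcos_inv[OF V w(1)] normal.rcos_inv[OF V zc[of l]] w z by (simp add: int_pow_neg)
      then show ?thesis using w(1) by (auto simp: W_def)
    qed
    show "v \<otimes> w \<in> W" if "v \<in> W" "w \<in> W" for v w
    proof -
      obtain l m :: int where w: "v \<in> carrier G" "V #> v = V #> z [^] l" "w \<in> carrier G" "V #> w = V #> z [^] m"
        using \<open>v \<in> W\<close> \<open>w \<in> W\<close> by (auto simp: W_def)
      have "V #> (v \<otimes> w) = V #> z [^] (l + m)"
        using normal.rcos_sum[OF V w(1,3)] normal.rcos_sum[OF V zc[of l] zc[of m]] w z by (simp add: int_pow_mult)
      then show ?thesis using w(1,3) by (auto simp: W_def)
    qed
  qed
  have VW: "V \<subseteq> W"
  proof
    fix v assume v: "v \<in> V"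
    have vc: "v \<in> carrier G" using subgroup.mem_carrier[OF Vs v] .
    have "V #> v = V #> z [^] (0::int)"
      using coset_join2[OF vc Vs v] subgroup.subset[OF Vs] by simp
    then show "v \<in> W" using vc unfolding W_def by blast
  qed
  obtain s where s: "\<And>k. k \<in> carrier G \<Longrightarrow> s k \<in> carrier G" "\<And>k. k \<in> carrier G \<Longrightarrow> W #> s k = W #> k"
    "\<And>k k'. W #> k = W #> k' \<Longrightarrow> s k = s k'"
    using exists_transversal[of W] by metis
  define R where "R = {k \<in> carrier G. V #> k = V #> s k}"
  show ?thesis
  proof (rule that)
    fix k k' assume k: "k \<in> carrier G" "k' \<in> carrier G" "V #> k = V #> k'"
    have "s k = s k'" by (rule s(3)[OF subset_coset_eq[OF Vs Ws VW k]])
    then show "k \<in> R \<longleftrightarrow> k' \<in> R" using k by (simp add: R_def)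
  next
    fix k assume k: "k \<in> carrier G"
    define w where "w = s k \<otimes> inv k"
    have "w \<in> W" unfolding w_def using r_coset_eq_iff[OF Ws s(1)[OF k] k] s(2)[OF k] by simp
    then obtain L :: int where wc: "w \<in> carrier G" and L: "V #> w = V #> z [^] L" unfolding W_def by blast
    have wk: "s k = w \<otimes> k" using k s(1)[OF k] by (simp add: w_def m_assoc)
    have R_iff: "z [^] l \<otimes> k \<in> R \<longleftrightarrow> int c dvd int l - L" for l :: nat
    proof -
      have zl: "z [^] l \<in> carrier G" using z by simp
      have "z [^] l \<in> W" unfolding W_def using zl z by (auto intro!: exI[of _ "int l"] simp: int_pow_int)
      then have "W #> (z [^] l \<otimes> k) = W #> k"
        using r_coset_eq_iff[OF Ws _ k, of "z [^] l \<otimes> k"] zl k by (simp add: m_assoc)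
      then have "s (z [^] l \<otimes> k) = s k" by (rule s(3))
      then have "z [^] l \<otimes> k \<in> R \<longleftrightarrow> V #> (z [^] l \<otimes> k) = V #> (w \<otimes> k)"
        using zl k wk by (simp add: R_def)
      also have "\<dots> \<longleftrightarrow> V #> z [^] l = V #> w"
      proof -
        have "k \<otimes> (inv k \<otimes> inv w) = inv w" using k wc by (simp add: m_assoc[symmetric])
        then show ?thesis
          using r_coset_eq_iff[OF Vs, of "z [^] l \<otimes> k" "w \<otimes> k"] r_coset_eq_iff[OF Vs zl wc] zl wc k
          by (simp add: m_assoc inv_mult_group)
      qed
      also have "\<dots> \<longleftrightarrow> int c dvd int l - L" using zeq[of "int l" L] L by (simp add: int_pow_int)
      finally show ?thesis .
    qed
    define l0 where "l0 = nat (L mod int c)"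
    have l0: "int l0 = L mod int c" "l0 < c"
      using c by (simp_all add: l0_def nat_less_iff)
    have "int c dvd int l - L \<longleftrightarrow> l = l0" if "l < c" for l
    proof -
      have "int c dvd int l - L \<longleftrightarrow> int l mod int c = L mod int c" by (simp add: mod_eq_dvd_iff)
      also have "int l mod int c = int l" using that by simp
      finally show ?thesis using l0(1) by linarith
    qed
    then show "\<exists>l0<c. \<forall>l<c. z [^] l \<otimes> k \<in> R \<longleftrightarrow> l = l0"
      using R_iff l0(2) by auto
  qed
qed

lemma (in group) comm_group_image_in_quotient:
  assumes N: "N \<lhd> G" and U: "subgroup U G"
    and comm: "\<And>u v. u \<in> U \<Longrightarrow> v \<in> U \<Longrightarrow> N #> (u \<otimes> v) = N #> (v \<otimes> u)"
  shows "subgroup ((\<lambda>u. N #> u) ` U) (G Mod N)"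
    and "comm_group ((G Mod N)\<lparr>carrier := (\<lambda>u. N #> u) ` U\<rparr>)"
proof -
  have h: "group_hom G (G Mod N) (\<lambda>u. N #> u)"
    using normal.r_coset_hom_Mod[OF N] normal.factorgroup_is_group[OF N] is_group
    by (simp add: group_hom_def group_hom_axioms_def)
  show sub: "subgroup ((\<lambda>u. N #> u) ` U) (G Mod N)"
    by (rule group_hom.subgroup_img_is_subgroup[OF h U])
  note Uc = subgroup.mem_carrier[OF U]
  have "group ((G Mod N)\<lparr>carrier := (\<lambda>u. N #> u) ` U\<rparr>)"
    using subgroup.subgroup_is_group[OF sub normal.factorgroup_is_group[OF N]] .
  then show "comm_group ((G Mod N)\<lparr>carrier := (\<lambda>u. N #> u) ` U\<rparr>)"
  proof (rule group.group_comm_groupI)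
    fix p q
    assume "p \<in> carrier ((G Mod N)\<lparr>carrier := (\<lambda>u. N #> u) ` U\<rparr>)"
      "q \<in> carrier ((G Mod N)\<lparr>carrier := (\<lambda>u. N #> u) ` U\<rparr>)"
    then obtain u v where u: "u \<in> U" "p = N #> u" "v \<in> U" "q = N #> v" by auto
    show "p \<otimes>\<^bsub>(G Mod N)\<lparr>carrier := (\<lambda>u. N #> u) ` U\<rparr>\<^esub> q
        = q \<otimes>\<^bsub>(G Mod N)\<lparr>carrier := (\<lambda>u. N #> u) ` U\<rparr>\<^esub> p"
      using normal.rcos_sum[OF N Uc[OF u(1)] Uc[OF u(3)]] normal.rcos_sum[OF N Uc[OF u(3)] Uc[OF u(1)]]
        comm[OF u(1,3)] u(2,4) by simp
  qed
qed

text \<open>This is the first component of the Kaloujnine-Krasner embedding of \<open>G/N\<close> into the wreath product of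
\<open>U/N\<close> by \<open>G/U\<close>: in a product the inner occurrences of \<open>t (k w)\<close> cancel.\<close>

lemma (in group) transversal_crossed_map:
  assumes N: "N \<lhd> G" and U: "U \<lhd> G"
    and comm: "\<And>u v. u \<in> U \<Longrightarrow> v \<in> U \<Longrightarrow> N #> (u \<otimes> v) = N #> (v \<otimes> u)"
    and t: "\<And>k. k \<in> carrier G \<Longrightarrow> t k \<in> carrier G" "\<And>k. k \<in> carrier G \<Longrightarrow> U #> t k = U #> k"
  shows "crossed_map G ((G Mod N)\<lparr>carrier := (\<lambda>u. N #> u) ` U\<rparr>)
           (\<lambda>w k. N #> (t k \<otimes> w \<otimes> inv t (k \<otimes> w)))"
  unfolding crossed_map_def crossed_map_axioms_def
proof (intro conjI allI impI is_group)
  have Us: "subgroup U G" using U by (rule normal_imp_subgroup)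
  show "comm_group ((G Mod N)\<lparr>carrier := (\<lambda>u. N #> u) ` U\<rparr>)"
    by (rule comm_group_image_in_quotient(2)[OF N Us comm])
  fix w k assume w: "w \<in> carrier G" "k \<in> carrier G"
  have "U #> (t k \<otimes> w) = U #> t (k \<otimes> w)"
    using normal.rcos_sum[OF U t(1)[OF w(2)] w(1)] normal.rcos_sum[OF U w(2,1)] t(2) w by simp
  then have "t k \<otimes> w \<otimes> inv t (k \<otimes> w) \<in> U"
    using r_coset_eq_iff[OF Us] t(1) w by simp
  then show "N #> (t k \<otimes> w \<otimes> inv t (k \<otimes> w)) \<in> carrier ((G Mod N)\<lparr>carrier := (\<lambda>u. N #> u) ` U\<rparr>)"
    by simp
next
  fix w w' k assume w: "w \<in> carrier G" "w' \<in> carrier G" "k \<in> carrier G"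
  let ?p = "t k \<otimes> w \<otimes> inv t (k \<otimes> w)" and ?q = "t (k \<otimes> w) \<otimes> w' \<otimes> inv t (k \<otimes> w \<otimes> w')"
  have tt: "t k \<in> carrier G" "t (k \<otimes> w) \<in> carrier G" "t (k \<otimes> w \<otimes> w') \<in> carrier G"
    using t(1) w by simp_all
  have "inv t (k \<otimes> w) \<otimes> (t (k \<otimes> w) \<otimes> (w' \<otimes> inv t (k \<otimes> w \<otimes> w'))) = w' \<otimes> inv t (k \<otimes> w \<otimes> w')"
    using tt w by (simp add: m_assoc[symmetric])
  then have "t k \<otimes> (w \<otimes> w') \<otimes> inv t (k \<otimes> w \<otimes> w') = ?p \<otimes> ?q"
    using tt w by (simp add: m_assoc)
  moreover have "(N #> ?p) <#> (N #> ?q) = N #> (?p \<otimes> ?q)"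
    using normal.rcos_sum[OF N, of ?p ?q] tt w by simp
  ultimately show "N #> (t k \<otimes> (w \<otimes> w') \<otimes> inv t (k \<otimes> (w \<otimes> w'))) =
      (N #> ?p) \<otimes>\<^bsub>(G Mod N)\<lparr>carrier := (\<lambda>u. N #> u) ` U\<rparr>\<^esub> (N #> (t (k \<otimes> w) \<otimes> w' \<otimes> inv t (k \<otimes> w \<otimes> w')))"
    using w by (simp add: m_assoc[symmetric])
qed

text \<open>Left translations of \<open>k\<close> commute with the right translations in the product rule, and since
\<open>A\<close> is abelian pointwise products of crossed maps are crossed maps.\<close>

lemma crossed_map_finprod:
  assumes d: "crossed_map F A d" and z: "\<And>l. l \<in> I \<Longrightarrow> z l \<in> carrier F"
  shows "crossed_map F A (\<lambda>w k. finprod A (\<lambda>l. d w (z l \<otimes>\<^bsub>F\<^esub> k)) I)"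
proof -
  interpret crossed_map F A d by (rule d)
  show ?thesis
    unfolding crossed_map_def crossed_map_axioms_def
  proof (intro conjI allI impI F.is_group A.comm_group_axioms)
    show "finprod A (\<lambda>l. d w (z l \<otimes>\<^bsub>F\<^esub> k)) I \<in> carrier A" if "w \<in> carrier F" "k \<in> carrier F" for w k
      using that z by (intro A.finprod_closed) simp
    fix w w' k assume w: "w \<in> carrier F" "w' \<in> carrier F" "k \<in> carrier F"
    have "finprod A (\<lambda>l. d (w \<otimes>\<^bsub>F\<^esub> w') (z l \<otimes>\<^bsub>F\<^esub> k)) I
        = finprod A (\<lambda>l. d w (z l \<otimes>\<^bsub>F\<^esub> k) \<otimes>\<^bsub>A\<^esub> d w' (z l \<otimes>\<^bsub>F\<^esub> (k \<otimes>\<^bsub>F\<^esub> w))) I"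
      using w z by (intro A.finprod_cong') (simp_all add: mult F.m_assoc)
    also have "\<dots> = finprod A (\<lambda>l. d w (z l \<otimes>\<^bsub>F\<^esub> k)) I
        \<otimes>\<^bsub>A\<^esub> finprod A (\<lambda>l. d w' (z l \<otimes>\<^bsub>F\<^esub> (k \<otimes>\<^bsub>F\<^esub> w))) I"
      using w z by (intro A.finprod_multf) simp_all
    finally show "finprod A (\<lambda>l. d (w \<otimes>\<^bsub>F\<^esub> w') (z l \<otimes>\<^bsub>F\<^esub> k)) I
        = finprod A (\<lambda>l. d w (z l \<otimes>\<^bsub>F\<^esub> k)) I
        \<otimes>\<^bsub>A\<^esub> finprod A (\<lambda>l. d w' (z l \<otimes>\<^bsub>F\<^esub> (k \<otimes>\<^bsub>F\<^esub> w))) I" .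
  qed
qed

context profinite
begin

text \<open>This is the product \<open>N K\<close>, written as a congruence because \<open>N\<close> is only used through
its cosets.\<close>

definition normal_product :: "'a set \<Rightarrow> 'a set \<Rightarrow> 'a set" where
  "normal_product N K = {w \<in> carrier G. \<exists>k\<in>K. N #> w = N #> k}"

lemma open_normal_product:
  assumes N: "open_normal G T N" and K: "K \<lhd> G"
  shows "open_normal G T (normal_product N K)" "N \<subseteq> normal_product N K" "K \<subseteq> normal_product N K"
proof -
  let ?U = "normal_product N K"
  note Nn = open_normalD(1)[OF N] and Ns = open_normalD(2)[OF N]
  have Ks: "subgroup K G" using K by (rule normal_imp_subgroup)
  note Kc = subgroup.mem_carrier[OF Ks]
  have memI: "w \<in> ?U" if "w \<in> carrier G" "k \<in> K" "N #> w = N #> k" for w k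
    using that by (auto simp: normal_product_def)
  have memE: "w \<in> carrier G \<and> (\<exists>k\<in>K. k \<in> carrier G \<and> N #> w = N #> k)" if "w \<in> ?U" for w
    using that Kc by (auto simp: normal_product_def)
  show KU: "K \<subseteq> ?U" using memI Kc by auto
  show NU: "N \<subseteq> ?U"
  proof
    fix v assume v: "v \<in> N"
    have "v \<in> carrier G" using v open_normalD(4)[OF N] by auto
    moreover have "N #> v = N #> \<one>"
      using coset_join2[OF \<open>v \<in> carrier G\<close> Ns v] open_normalD(4)[OF N] by simp
    ultimately show "v \<in> ?U" using memI subgroup.one_closed[OF Ks] by simp
  qed
  have "?U \<lhd> G"
    unfolding normal_inv_iff
  proof (intro conjI ballI)
    show "subgroup ?U G"
    proof (rule subgroupI)
      show "?U \<subseteq> carrier G" using memE by auto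
      show "?U \<noteq> {}" using KU subgroup.one_closed[OF Ks] by auto
      show "inv w \<in> ?U" if w: "w \<in> ?U" for w
      proof -
        obtain k where k: "w \<in> carrier G" "k \<in> K" "k \<in> carrier G" "N #> w = N #> k" using memE[OF w] by auto
        then show ?thesis using memI coset_inv[OF Nn k(1,3,4)] subgroup.m_inv_closed[OF Ks k(2)] by simp
      qed
      show "v \<otimes> w \<in> ?U" if v: "v \<in> ?U" "w \<in> ?U" for v w
      proof -
        obtain k where k: "v \<in> carrier G" "k \<in> K" "k \<in> carrier G" "N #> v = N #> k" using memE[OF v(1)] by auto
        obtain l where l: "w \<in> carrier G" "l \<in> K" "l \<in> carrier G" "N #> w = N #> l" using memE[OF v(2)] by auto
        show ?thesis using memI[OF _ _ coset_mult[OF Nn k(1) l(1) k(3) l(3) k(4) l(4)]]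
            subgroup.m_closed[OF Ks k(2) l(2)] k(1) l(1) by simp
      qed
    qed
    fix x w assume x: "x \<in> carrier G" and w: "w \<in> ?U"
    obtain k where k: "w \<in> carrier G" "k \<in> K" "k \<in> carrier G" "N #> w = N #> k" using memE[OF w] by auto
    have "N #> (x \<otimes> w) = N #> (x \<otimes> k)" by (rule coset_mult[OF Nn x k(1) x k(3) refl k(4)])
    then have "N #> (x \<otimes> w \<otimes> inv x) = N #> (x \<otimes> k \<otimes> inv x)"
      using x k by (intro coset_mult[OF Nn]) simp_all
    then show "x \<otimes> w \<otimes> inv x \<in> ?U"
      using memI normal.inv_op_closed2[OF K x k(2)] x k(1) by simp
  qed
  then show "open_normal G T ?U" using open_normal_superset[OF _ N NU] by simp
qed

end


section \<open>Centralizers of powers modulo the derived series\<close>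

context free_pro_C
begin

text \<open>Take the kernel of the homomorphism to the cyclic group of order \<open>M\<close> that sends \<open>x\<close> to
a generator and the other basis elements to the identity; it contains all commutators, as its target is abelian.\<close>

lemma exists_cyclic_quotient:
  assumes M: "M > 0" "in_class C (integer_mod_group M)" and x: "x \<in> B"
  obtains V where "open_normal F T V" "closed_derived F T (Suc 0) \<subseteq> V"
    "\<And>j::int. x [^] j \<in> V \<longleftrightarrow> int M dvd j"
proof -
  let ?A = "integer_mod_group M"
  have xF: "x \<in> carrier F" using x basis_subset by (rule rev_subsetD)
  define \<phi> where "\<phi> = (\<lambda>y. if y = x then 1 mod int M else 0)"
  have "\<phi> \<in> B \<rightarrow> carrier ?A"
    using M(1) by (simp add: \<phi>_def carrier_integer_mod_group)
  moreover have "finite {y \<in> B. \<phi> y \<noteq> \<one>\<^bsub>?A\<^esub>}"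
    by (rule finite_subset[of _ "{x}"]) (auto simp: \<phi>_def)
  ultimately obtain f where f: "f \<in> hom F ?A" "\<And>y. y \<in> B \<Longrightarrow> f y = \<phi> y"
      "open_normal F T (kernel F ?A f)"
    by (rule extend_to_finite[OF M(2)]) (rule that, simp_all)
  have gh: "group_hom F ?A f"
    using f(1) is_group by (simp add: group_hom_def group_hom_axioms_def)
  let ?V = "kernel F ?A f"
  have "closed_derived F T (Suc 0) \<subseteq> ?V"
  proof (rule closed_derived_Suc_subset[OF open_normalD(2)[OF f(3)] f(3) subset_refl])
    fix g h assume "g \<in> closed_derived F T 0" "h \<in> closed_derived F T 0"
    then have gh': "g \<in> carrier F" "h \<in> carrier F" by simp_all
    have "f (g \<otimes> h) = f (h \<otimes> g)"
      using hom_mult[OF f(1)] gh' by (simp add: add.commute)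
    then have "?V #> (g \<otimes> h) = ?V #> (h \<otimes> g)"
      using group_hom.hom_inv[OF gh, of "h \<otimes> g"] hom_mult[OF f(1), of "g \<otimes> h" "inv (h \<otimes> g)"] gh'
        group.r_inv[OF group_integer_mod_group hom_in_carrier[OF f(1)], of "h \<otimes> g"]
      by (subst r_coset_eq_iff[OF open_normalD(2)[OF f(3)]]) (simp_all add: kernel_def)
    then show "g \<otimes> h \<otimes> inv g \<otimes> inv h \<in> ?V"
      using r_coset_eq_iff[OF open_normalD(2)[OF f(3)], of "g \<otimes> h" "h \<otimes> g"] gh'
      by (simp add: inv_mult_group m_assoc)
  qed
  moreover have "x [^] j \<in> ?V \<longleftrightarrow> int M dvd j" for j :: int
  proof -
    have "f (x [^] j) = (j * (1 mod int M)) mod int M"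
      using hom_int_pow[OF f(1) xF is_group group_integer_mod_group] f(2)[OF x, unfolded \<phi>_def]
      by (simp add: int_pow_integer_mod_group)
    also have "\<dots> = j mod int M" by (simp add: mod_simps)
    finally show ?thesis using xF by (simp add: kernel_def dvd_eq_mod_eq_0)
  qed
  ultimately show ?thesis using that[OF f(3)] by simp
qed

text \<open>The crossed map \<open>\<kappa>\<close> of a transversal of
\<open>U = N F\<^sup>(\<^sup>i\<^sup>+\<^sup>1\<^sup>)\<close> detects whether an element of \<open>U\<close>
lies in \<open>N\<close>. It is a product of \<open>|U/N|\<close> translates, by powers of an element
\<open>z\<close>, of a crossed map \<open>d\<close> on finer cosets. At an element of the finer subgroup that
commutes with \<open>z\<close> modulo \<open>F\<^sup>(\<^sup>i\<^sup>+\<^sup>2\<^sup>)\<close>, these translates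
coincide, so the product is a \<open>|U/N|\<close>-th power and hence trivial.\<close>

lemma centralizer_of_power_mod_derived:
  assumes N: "open_normal F T N" and DN: "closed_derived F T (Suc (Suc i)) \<subseteq> N"
    and x: "x \<in> B" and n: "n > 0" and g: "g \<in> carrier F"
    and comm: "closed_derived F T (Suc (Suc i)) #> (g \<otimes> x [^] (n::nat)) =
      closed_derived F T (Suc (Suc i)) #> (x [^] n \<otimes> g)"
    and q: "prime q" "in_class C (integer_mod_group q)"
  shows "\<exists>j::int. N #> g = N #> x [^] j"
proof -
  let ?K = "closed_derived F T (Suc i)" and ?D = "closed_derived F T (Suc (Suc i))"
  note Nn = open_normalD(1)[OF N] and Ns = open_normalD(2)[OF N]
  have Kn: "?K \<lhd> F" and Dn: "?D \<lhd> F" by (rule closed_derived_normal)+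
  have Kc: "k \<in> carrier F" if "k \<in> ?K" for k
    using subgroup.mem_carrier[OF normal_imp_subgroup[OF Kn] that] .
  have xF: "x \<in> carrier F" using x basis_subset by (rule rev_subsetD)
  define U where "U = normal_product N ?K"
  have U: "open_normal F T U" and NU: "N \<subseteq> U" and KU: "?K \<subseteq> U"
    unfolding U_def by (rule open_normal_product[OF N Kn])+
  note Un = open_normalD(1)[OF U] and Us = open_normalD(2)[OF U]
  have Uc: "u \<in> carrier F" if "u \<in> U" for u using subgroup.mem_carrier[OF Us that] .
  have Ucomm: "N #> (u \<otimes> v) = N #> (v \<otimes> u)" if u: "u \<in> U" "v \<in> U" for u v
  proof -
    obtain k where k: "k \<in> ?K" "N #> u = N #> k" using u(1) by (auto simp: U_def normal_product_def)
    obtain l where l: "l \<in> ?K" "N #> v = N #> l" using u(2) by (auto simp: U_def normal_product_def)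
    note c = Uc[OF u(1)] Uc[OF u(2)] Kc[OF k(1)] Kc[OF l(1)]
    have "N #> (k \<otimes> l) = N #> (l \<otimes> k)"
      using subsetD[OF DN commutator_in_closed_derived[OF k(1) l(1)]] c
        r_coset_eq_iff[OF Ns, of "k \<otimes> l" "l \<otimes> k"] by (simp add: inv_mult_group m_assoc)
    then show ?thesis
      using coset_mult[OF Nn c(1,2,3,4) k(2) l(2)] coset_mult[OF Nn c(2,1,4,3) l(2) k(2)] by simp
  qed
  let ?A = "(F Mod N)\<lparr>carrier := (\<lambda>u. N #> u) ` U\<rparr>"
  have Acomm: "comm_group ?A" and Asub: "subgroup ((\<lambda>u. N #> u) ` U) (F Mod N)"
    by (rule comm_group_image_in_quotient[OF Nn Us Ucomm], assumption+)+
  have AC: "in_class C ?A" by (rule in_class_subgroup[OF full in_class_Mod[OF N] Asub])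
  have Agrp: "group ?A" by (rule in_class_group[OF AC])
  have Afin: "finite (carrier ?A)" by (rule in_class_finite[OF full AC])
  define c where "c = order ?A"
  have c: "c > 0" unfolding c_def using monoid.order_gt_0_iff_finite[OF group.is_monoid[OF Agrp]] Afin by simp
  \<comment> \<open>The factor \<open>n\<close> makes \<open>z\<close> a power of \<open>x\<^sup>n\<close>, and the order of the quotient puts it into \<open>U\<close>.\<close>
  define e where "e = n * order (F Mod U)"
  have gQ: "group (F Mod U)" by (rule in_class_group[OF in_class_Mod[OF U]])
  have "order (F Mod U) > 0" using monoid.order_gt_0_iff_finite[OF group.is_monoid[OF gQ]] finite_Mod[OF U] by simp
  then have e: "e > 0" using n by (simp add: e_def)
  define z where "z = x [^] e"
  have zF: "z \<in> carrier F" using xF by (simp add: z_def)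
  have zU: "z [^] l \<in> U" for l :: int
  proof -
    let ?h = "order (F Mod U)"
    have xn: "x [^] n \<in> carrier F" using xF by simp
    have "(U #> x [^] n) [^]\<^bsub>F Mod U\<^esub> ?h = \<one>\<^bsub>F Mod U\<^esub>"
      using xn by (intro group.pow_order_eq_1[OF gQ]) (simp add: carrier_FactGroup)
    then have "U #> z = U"
      using normal.FactGroup_pow[OF Un xn] xF by (simp add: z_def e_def nat_pow_pow)
    then have "z \<in> U" by (rule coset_join1[OF _ zF Us])
    then show ?thesis using subgroup_int_pow_closed[OF Us] by simp
  qed
  obtain M where M: "M > 0" "\<And>p. prime p \<Longrightarrow> p dvd M \<Longrightarrow> p dvd c" "\<And>j. M dvd e * j \<longleftrightarrow> c dvd j"
    using exists_modulus[OF c e] by metis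
  have MC: "in_class C (integer_mod_group M)"
    using in_class_prime_cyclic[OF full nonempty AC] M(2)
    by (intro in_class_cyclic[OF full nonempty M(1)]) (simp add: c_def)
  obtain V' where V': "open_normal F T V'" "closed_derived F T (Suc 0) \<subseteq> V'"
      "\<And>j::int. x [^] j \<in> V' \<longleftrightarrow> int M dvd j"
    using exists_cyclic_quotient[OF M(1) MC x] by metis
  \<comment> \<open>In \<open>V'\<close> the element \<open>x\<close> has order \<open>M\<close>, so by the choice of \<open>M\<close> its power \<open>z\<close> has order \<open>c\<close>.\<close>
  define V where "V = U \<inter> V'"
  have V: "open_normal F T V" unfolding V_def by (rule open_normal_Int[OF U V'(1)])
  note Vn = open_normalD(1)[OF V] and Vs = open_normalD(2)[OF V]
  have VU: "V \<subseteq> U" by (simp add: V_def)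
  have KV: "?K \<subseteq> V" using KU V'(2) closed_derived_antimono[of "Suc 0" "Suc i"] by (simp add: V_def)
  have ord: "z [^] j \<in> V \<longleftrightarrow> int c dvd j" for j :: int
  proof -
    have "z [^] j = x [^] (int e * j)"
      using xF by (simp add: z_def int_pow_pow flip: int_pow_int)
    then have "z [^] j \<in> V \<longleftrightarrow> int M dvd int e * j" using zU[of j] V'(3) by (simp add: V_def)
    also have "\<dots> \<longleftrightarrow> M dvd e * nat \<bar>j\<bar>" by (simp add: nat_abs_mult_distrib flip: nat_abs_dvd_iff dvd_nat_abs_iff)
    also have "\<dots> \<longleftrightarrow> int c dvd j" using M(3) by (simp flip: dvd_nat_abs_iff)
    finally show ?thesis .
  qed
  obtain R where RV: "\<And>k k'. k \<in> carrier F \<Longrightarrow> k' \<in> carrier F \<Longrightarrow> V #> k = V #> k' \<Longrightarrow> k \<in> R \<longleftrightarrow> k' \<in> R"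
    and R: "\<And>k. k \<in> carrier F \<Longrightarrow> \<exists>l0<c. \<forall>l<c. z [^] (l::nat) \<otimes> k \<in> R \<longleftrightarrow> l = l0"
    using exists_cyclic_transversal[OF Vn zF c ord] by metis
  obtain t where t: "\<And>k. k \<in> carrier F \<Longrightarrow> t k \<in> carrier F" "\<And>k. k \<in> carrier F \<Longrightarrow> U #> t k = U #> k"
    "\<And>k k'. U #> k = U #> k' \<Longrightarrow> t k = t k'"
    using exists_transversal[of U] by metis
  define \<kappa> where "\<kappa> = (\<lambda>w k. N #> (t k \<otimes> w \<otimes> inv t (k \<otimes> w)))"
  have \<kappa>: "crossed_map F ?A \<kappa>"
    unfolding \<kappa>_def by (rule transversal_crossed_map[OF Nn Un Ucomm t(1,2)])
  have \<kappa>U: "\<kappa> w k = \<kappa> w k'"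
    if "w \<in> carrier F" "k \<in> carrier F" "k' \<in> carrier F" "U #> k = U #> k'" for w k k'
  proof -
    have "U #> (k \<otimes> w) = U #> (k' \<otimes> w)" by (rule coset_mult[OF Un that(2,1,3,1,4) refl])
    then show ?thesis using t(3)[OF that(4)] t(3)[of "k \<otimes> w" "k' \<otimes> w"] by (simp add: \<kappa>_def)
  qed
  have t_U: "t (k \<otimes> w) = t k" if "w \<in> U" "k \<in> carrier F" for w k
  proof (rule t(3))
    have "k \<otimes> w \<otimes> inv k \<in> U" by (rule normal.inv_op_closed2[OF Un that(2,1)])
    then show "U #> (k \<otimes> w) = U #> k" using r_coset_eq_iff[OF Us] that Uc by simp
  qed
  have \<kappa>N: "\<kappa> w k = \<one>\<^bsub>?A\<^esub>" if w: "w \<in> N" and k: "k \<in> carrier F" for w k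
  proof -
    have "t k \<otimes> w \<otimes> inv t k \<in> N" by (rule normal.inv_op_closed2[OF Nn t(1)[OF k] w])
    then have "N #> (t k \<otimes> w \<otimes> inv t k) = N"
      using coset_join2[OF _ Ns] open_normalD(4)[OF N] by auto
    then show ?thesis using t_U[OF subsetD[OF NU w] k] by (simp add: \<kappa>_def)
  qed
  have \<kappa>A: "\<kappa> w k \<in> carrier ?A" if "w \<in> carrier F" "k \<in> carrier F" for w k
    using crossed_map.closed[OF \<kappa> that] .
  \<comment> \<open>Restricting \<open>\<kappa>\<close> to \<open>R\<close> leaves exactly one nontrivial factor in the product over the translates.\<close>
  define a where "a = (\<lambda>y k. if k \<in> R then \<kappa> y k else \<one>\<^bsub>?A\<^esub>)"
  have BF: "y \<in> carrier F" if "y \<in> B" for y using that basis_subset by (rule rev_subsetD)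
  have one_A: "\<one>\<^bsub>?A\<^esub> \<in> carrier ?A" by (rule monoid.one_closed[OF group.is_monoid[OF Agrp]])
  have a1: "a y k \<in> carrier ?A" if "y \<in> B" "k \<in> carrier F" for y k
    unfolding a_def using \<kappa>A[OF BF[OF that(1)] that(2)] one_A by (cases "k \<in> R") (simp_all only: if_True if_False)
  have a2: "a y k = a y k'" if y: "y \<in> B" and k: "k \<in> carrier F" "k' \<in> carrier F" "V #> k = V #> k'" for y k k'
    unfolding a_def using RV[OF k] \<kappa>U[OF BF[OF y] k(1,2) subset_coset_eq[OF Vs Us VU k]] by simp
  have "{y \<in> B. \<exists>k\<in>carrier F. a y k \<noteq> \<one>\<^bsub>?A\<^esub>} \<subseteq> {y \<in> B. y \<notin> N}"
  proof (intro subsetI CollectI)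
    fix y assume y: "y \<in> {y \<in> B. \<exists>k\<in>carrier F. a y k \<noteq> \<one>\<^bsub>?A\<^esub>}"
    have "y \<notin> N"
    proof
      assume "y \<in> N"
      then have "a y k = \<one>\<^bsub>?A\<^esub>" if "k \<in> carrier F" for k using \<kappa>N[OF _ that] unfolding a_def by metis
      then show False using y by blast
    qed
    then show "y \<in> B \<and> y \<notin> N" using y by simp
  qed
  then have a3: "finite {y \<in> B. \<exists>k\<in>carrier F. a y k \<noteq> \<one>\<^bsub>?A\<^esub>}"
    by (rule finite_subset[OF _ basis_converges[OF N]])
  obtain d N' where d: "crossed_map F ?A d"
    and dV: "\<And>w k k'. k \<in> carrier F \<Longrightarrow> k' \<in> carrier F \<Longrightarrow> V #> k = V #> k' \<Longrightarrow> d w k = d w k'"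
    and da: "\<And>y k. y \<in> B \<Longrightarrow> k \<in> carrier F \<Longrightarrow> d y k = a y k"
    and N': "open_normal F T N'" and dN: "\<And>w k. w \<in> N' \<Longrightarrow> k \<in> carrier F \<Longrightarrow> d w k = \<one>\<^bsub>?A\<^esub>"
    and dD: "\<And>g u k. g \<in> carrier F \<Longrightarrow> u \<in> carrier F \<Longrightarrow> k \<in> carrier F \<Longrightarrow>
       ?D #> (g \<otimes> u) = ?D #> (u \<otimes> g) \<Longrightarrow>
       d g k \<otimes>\<^bsub>?A\<^esub> d u (k \<otimes> g) = d u k \<otimes>\<^bsub>?A\<^esub> d g (k \<otimes> u)"
  proof (rule exists_crossed_map_commute[where a = a, OF V AC Acomm KV], goal_cases)
    case (1 y k)
    show ?case by (rule a1[OF 1(2,3)])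
  next
    case (2 y k k')
    show ?case by (rule a2[OF 2(2-5)])
  next
    case 3
    show ?case by (rule a3)
  next
    case (4 d N)
    show ?case by (rule that[OF 4(2-7)])
  qed
  have zl: "z [^] l \<in> carrier F" for l :: nat using zF by simp
  define E where "E = (\<lambda>w k. finprod ?A (\<lambda>l. d w (z [^] l \<otimes> k)) {..<c})"
  have E: "crossed_map F ?A E"
    unfolding E_def by (rule crossed_map_finprod[OF d zl])
  interpret A: comm_group ?A by (rule Acomm)
  have E_basis: "E y k = \<kappa> y k" if y: "y \<in> B" and k: "k \<in> carrier F" for y k
  proof -
    obtain l0 where l0: "l0 < c" "\<forall>l<c. z [^] l \<otimes> k \<in> R \<longleftrightarrow> l = l0" using R[OF k] by metis
    have \<kappa>z: "\<kappa> y (z [^] l \<otimes> k) = \<kappa> y k" for l :: nat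
    proof (rule \<kappa>U[OF BF[OF y] _ k])
      show "z [^] l \<otimes> k \<in> carrier F" using zl k by simp
      have "z [^] l \<otimes> k \<otimes> inv k \<in> U" using zU[of "int l"] zl k by (simp add: m_assoc int_pow_int)
      then show "U #> (z [^] l \<otimes> k) = U #> k" using r_coset_eq_iff[OF Us] zl k by simp
    qed
    have "d y (z [^] l \<otimes> k) = (if l = l0 then \<kappa> y k else \<one>\<^bsub>?A\<^esub>)" if "l \<in> {..<c}" for l
    proof -
      have "z [^] l \<otimes> k \<in> R \<longleftrightarrow> l = l0" using l0(2) that by (simp only: lessThan_iff)
      then show ?thesis using da[OF y, of "z [^] l \<otimes> k"] zl k \<kappa>z[of l] unfolding a_def by (simp only: m_closed)
    qed
    then have "E y k = finprod ?A (\<lambda>l. if l = l0 then \<kappa> y k else \<one>\<^bsub>?A\<^esub>) {..<c}"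
      unfolding E_def using \<kappa>A[OF BF[OF y] k] one_A by (intro A.finprod_cong') auto
    also have "\<dots> = \<kappa> y k"
      using l0(1) \<kappa>A[OF BF[OF y] k] by (intro A.finprod_singleton_swap) auto
    finally show ?thesis .
  qed
  have E_eq: "E w k = \<kappa> w k" if w: "w \<in> carrier F" and k: "k \<in> carrier F" for w k
  proof (rule crossed_map_eq_if_eq_on_basis[OF E \<kappa> open_normal_Int[OF N' N] _ _ E_basis w k])
    fix w k assume wk: "w \<in> N' \<inter> N" "k \<in> carrier F"
    show "E w k = \<one>\<^bsub>?A\<^esub>"
      unfolding E_def using dN wk zl by (intro A.finprod_one_eqI) (simp only: Int_iff m_closed)
    show "\<kappa> w k = \<one>\<^bsub>?A\<^esub>" using \<kappa>N wk by (simp only: Int_iff)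
  qed
  have "\<exists>j::int. V #> g = V #> x [^] j"
    by (rule centralizer_of_power_mod_open_normal[OF V KV x n g comm q])
  then obtain j :: int where j: "V #> g = V #> x [^] j" by metis
  have xj: "x [^] j \<in> carrier F" using xF by simp
  define g' where "g' = g \<otimes> inv (x [^] j)"
  have g'F: "g' \<in> carrier F" using g xj by (simp add: g'_def)
  have g'V: "g' \<in> V" unfolding g'_def using r_coset_eq_iff[OF Vs g xj] j by simp
  have g'U: "g' \<in> U" using g'V VU by auto
  have comm': "?D #> (g' \<otimes> z [^] l) = ?D #> (z [^] l \<otimes> g')" for l :: nat
  proof -
    have xn: "x [^] n \<in> carrier F" using xF by simp
    have xx: "inv (x [^] j) \<otimes> x [^] n = x [^] n \<otimes> inv (x [^] j)"
    proof -
      have "x [^] (- j) \<otimes> x [^] (int n) = x [^] (int n) \<otimes> x [^] (- j)"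
        using xF by (simp only: int_pow_mult[symmetric] add.commute)
      then show ?thesis using xF by (simp add: int_pow_neg int_pow_int)
    qed
    have "g' \<otimes> x [^] n = (g \<otimes> x [^] n) \<otimes> inv (x [^] j)"
      using g xj xn xx by (simp add: g'_def m_assoc)
    moreover have "x [^] n \<otimes> g' = (x [^] n \<otimes> g) \<otimes> inv (x [^] j)"
      using g xj xn by (simp add: g'_def m_assoc)
    moreover have "?D #> ((g \<otimes> x [^] n) \<otimes> inv (x [^] j)) = ?D #> ((x [^] n \<otimes> g) \<otimes> inv (x [^] j))"
      by (rule coset_mult[OF Dn _ _ _ _ comm refl]) (simp_all add: g xj xn)
    ultimately have "?D #> (g' \<otimes> x [^] n) = ?D #> (x [^] n \<otimes> g')" by simp
    then have "?D #> (g' \<otimes> (x [^] n) [^] (order (F Mod U) * l)) = ?D #> ((x [^] n) [^] (order (F Mod U) * l) \<otimes> g')"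
      by (rule coset_commute_pow[OF Dn g'F xn])
    then show ?thesis using xF by (simp add: z_def e_def nat_pow_pow mult.assoc)
  qed
  \<comment> \<open>As \<open>g'\<close> lies in \<open>V\<close>, the two occurrences of \<open>d (z\<^sup>l)\<close> in the commutation identity cancel.\<close>
  have dz: "d g' (z [^] l \<otimes> \<one>) = d g' \<one>" for l :: nat
  proof -
    have "d (z [^] l) g' = d (z [^] l) \<one>"
    proof (rule dV[OF g'F one_closed])
      show "V #> g' = V #> \<one>"
        using coset_join2[OF g'F Vs g'V] open_normalD(4)[OF V] by simp
    qed
    then have swap: "d g' \<one> \<otimes>\<^bsub>?A\<^esub> d (z [^] l) \<one> = d (z [^] l) \<one> \<otimes>\<^bsub>?A\<^esub> d g' (z [^] l)"
      using dD[OF g'F zl one_closed comm', of l] unfolding l_one[OF g'F] l_one[OF zl] by (simp only:)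
    have cA: "d (z [^] l) \<one> \<in> carrier ?A" "d g' (z [^] l) \<in> carrier ?A" "d g' \<one> \<in> carrier ?A"
      by (rule crossed_map.closed[OF d], rule zl g'F, rule zl g'F one_closed)+
    have "d g' \<one> = d g' (z [^] l)"
      by (rule comm_group.cancel_swap[OF Acomm cA swap])
    then show ?thesis by (simp only: r_one[OF zl])
  qed
  have "\<kappa> g' \<one> = E g' \<one>" by (rule E_eq[OF g'F one_closed, symmetric])
  also have "\<dots> = finprod ?A (\<lambda>l. d g' \<one>) {..<c}" by (simp only: E_def dz)
  also have "\<dots> = d g' \<one> [^]\<^bsub>?A\<^esub> c"
    using A.finprod_const[OF crossed_map.closed[OF d g'F one_closed], of "{..<c}"]
    by (simp only: card_lessThan)
  also have "\<dots> = \<one>\<^bsub>?A\<^esub>"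
    unfolding c_def by (rule A.pow_order_eq_1[OF crossed_map.closed[OF d g'F one_closed]])
  finally have "N #> (t \<one> \<otimes> g' \<otimes> inv t \<one>) = N"
    using t_U[OF g'U one_closed] by (simp add: \<kappa>_def)
  moreover have tF: "t \<one> \<in> carrier F" using t(1)[OF one_closed] .
  ultimately have "t \<one> \<otimes> g' \<otimes> inv t \<one> \<in> N"
    using coset_join1[OF _ _ Ns] g'F by simp
  then have "inv t \<one> \<otimes> (t \<one> \<otimes> g' \<otimes> inv t \<one>) \<otimes> t \<one> \<in> N"
    by (rule normal.inv_op_closed1[OF Nn tF])
  moreover have "inv t \<one> \<otimes> (t \<one> \<otimes> g' \<otimes> inv t \<one>) \<otimes> t \<one> = g'"
  proof -
    have "inv t \<one> \<otimes> (t \<one> \<otimes> (g' \<otimes> (inv t \<one> \<otimes> t \<one>))) = g'"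
      using tF g'F by (simp add: m_assoc[symmetric])
    then show ?thesis using tF g'F by (simp add: m_assoc)
  qed
  ultimately have "g' \<in> N" by simp
  then have "N #> g = N #> x [^] j"
    using r_coset_eq_iff[OF Ns g xj] by (simp add: g'_def)
  then show ?thesis by (rule exI)
qed

end


section \<open>Centralizers and closures in the quotient topology\<close>

lemma topspace_quotient_group_topology:
  assumes "topspace T = carrier G"
  shows "topspace (quotient_group_topology G T N) = carrier (G Mod N)"
proof
  show "topspace (quotient_group_topology G T N) \<subseteq> carrier (G Mod N)"
    using openin_topspace[of "quotient_group_topology G T N"] unfolding openin_quotient_group_topology by (rule conjunct1)
  have "{g \<in> topspace T. N #>\<^bsub>G\<^esub> g \<in> carrier (G Mod N)} = topspace T"
    using assms by (auto simp: carrier_FactGroup)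
  then have "openin (quotient_group_topology G T N) (carrier (G Mod N))"
    by (simp add: openin_quotient_group_topology)
  then show "carrier (G Mod N) \<subseteq> topspace (quotient_group_topology G T N)" by (rule openin_subset)
qed

context profinite
begin

text \<open>The preimage of the centralizer consists of the \<open>g\<close> whose commutator with \<open>a\<close> lies in
\<open>D\<close>, and modulo an open normal subgroup this commutator only depends on the coset of
\<open>g\<close>.\<close>

lemma closedin_centralizer_quotient:
  assumes D: "D \<lhd> G" "closedin T D" and a: "a \<in> carrier G"
  shows "closedin (quotient_group_topology G T D) (centralizer (G Mod D) (D #> a))"
proof -
  let ?Z = "centralizer (G Mod D) (D #> a)"
  let ?P = "{g \<in> topspace T. D #> g \<in> carrier (G Mod D) - ?Z}"
  have Ds: "subgroup D G" using D(1) by (rule normal_imp_subgroup)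
  have P: "g \<in> ?P \<longleftrightarrow> g \<otimes> a \<otimes> inv g \<otimes> inv a \<notin> D" if g: "g \<in> carrier G" for g
  proof -
    have "D #> g \<in> ?Z \<longleftrightarrow> D #> (g \<otimes> a) = D #> (a \<otimes> g)"
      using normal.rcos_sum[OF D(1) g a] normal.rcos_sum[OF D(1) a g] g
      by (auto simp: centralizer_def carrier_FactGroup)
    also have "\<dots> \<longleftrightarrow> g \<otimes> a \<otimes> inv g \<otimes> inv a \<in> D"
      using r_coset_eq_iff[OF Ds, of "g \<otimes> a" "a \<otimes> g"] g a by (simp add: inv_mult_group m_assoc)
    finally show ?thesis using g by (simp add: topspace_eq carrier_FactGroup)
  qed
  have "openin T ?P"
  proof (subst openin_iff_cosets, intro conjI ballI)
    show "?P \<subseteq> carrier G" using topspace_eq by auto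
    fix g assume gP: "g \<in> ?P"
    then have g: "g \<in> carrier G" using topspace_eq by simp
    let ?c = "\<lambda>g. g \<otimes> a \<otimes> inv g \<otimes> inv a"
    have "openin T (carrier G - D)" using D(2) topspace_eq by (metis closedin_def)
    moreover have "?c g \<in> carrier G - D" using gP P[OF g] g a by simp
    ultimately obtain N where N: "open_normal G T N" "\<forall>h\<in>carrier G. N #> h = N #> ?c g \<longrightarrow> h \<in> carrier G - D"
      unfolding openin_iff_cosets[of "carrier G - D"] by meson
    note Nn = open_normalD(1)[OF N(1)]
    have "h \<in> ?P" if h: "h \<in> carrier G" "N #> h = N #> g" for h
    proof -
      have "N #> (h \<otimes> a) = N #> (g \<otimes> a)" by (rule coset_mult[OF Nn h(1) a g a h(2) refl])
      then have "N #> (h \<otimes> a \<otimes> inv h) = N #> (g \<otimes> a \<otimes> inv g)"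
        by (rule coset_mult[OF Nn _ _ _ _ _ coset_inv[OF Nn h(1) g h(2)], rotated 4]) (simp_all add: h(1) a g)
      then have "N #> ?c h = N #> ?c g"
        by (rule coset_mult[OF Nn _ _ _ _ _ refl, rotated 4]) (simp_all add: h(1) a g)
      then have "?c h \<notin> D" using N(2) h(1) a by simp
      then show ?thesis using P[OF h(1)] by simp
    qed
    with N(1) show "\<exists>N. open_normal G T N \<and> (\<forall>h\<in>carrier G. N #> h = N #> g \<longrightarrow> h \<in> ?P)"
      by (intro exI[of _ N]) simp
  qed
  then have "openin (quotient_group_topology G T D) (carrier (G Mod D) - ?Z)"
    by (simp only: openin_quotient_group_topology Diff_subset simp_thms)
  moreover have "?Z \<subseteq> carrier (G Mod D)" by (auto simp: centralizer_def)
  ultimately show ?thesis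
    using topspace_quotient_group_topology[OF topspace_eq] by (simp add: closedin_def)
qed

text \<open>A neighbourhood of \<open>D g\<close> pulls back to a set that is a union of cosets of \<open>D\<close> and
contains \<open>N g\<close> for some open normal \<open>N\<close>. Approximating \<open>g\<close> modulo the
larger subgroup \<open>N D\<close> is enough, since the factor from \<open>D\<close> can be absorbed.\<close>

lemma in_closure_quotient:
  assumes D: "D \<lhd> G" and g: "g \<in> carrier G" and S: "S \<subseteq> carrier G"
    and approx: "\<And>N. open_normal G T N \<Longrightarrow> D \<subseteq> N \<Longrightarrow> \<exists>s\<in>S. N #> g = N #> s"
  shows "D #> g \<in> quotient_group_topology G T D closure_of ((\<lambda>s. D #> s) ` S)"
  unfolding in_closure_of topspace_quotient_group_topology[OF topspace_eq]
proof (intro conjI allI impI)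
  have Ds: "subgroup D G" using D by (rule normal_imp_subgroup)
  show "D #> g \<in> carrier (G Mod D)" using g by (simp add: carrier_FactGroup)
  fix W assume W: "D #> g \<in> W \<and> openin (quotient_group_topology G T D) W"
  let ?P = "{h \<in> topspace T. D #> h \<in> W}"
  have "openin T ?P" using W by (simp add: openin_quotient_group_topology)
  moreover have "g \<in> ?P" using W g topspace_eq by simp
  ultimately obtain N where N: "open_normal G T N" "\<forall>h\<in>carrier G. N #> h = N #> g \<longrightarrow> h \<in> ?P"
    unfolding openin_iff_cosets[of ?P] by meson
  note Nn = open_normalD(1)[OF N(1)]
  note M = open_normal_product[OF N(1) D]
  obtain s where s: "s \<in> S" "normal_product N D #> g = normal_product N D #> s"
    using approx[OF M(1,3)] by auto
  have sc: "s \<in> carrier G" using s S by auto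
  have "s \<otimes> inv g \<in> normal_product N D"
    using r_coset_eq_iff[OF open_normalD(2)[OF M(1)] sc g] s(2) by simp
  then obtain k where k: "k \<in> D" "N #> (s \<otimes> inv g) = N #> k" by (auto simp: normal_product_def)
  have kc: "k \<in> carrier G" using subgroup.mem_carrier[OF Ds k(1)] .
  define h where "h = inv k \<otimes> s"
  have hc: "h \<in> carrier G" using kc sc by (simp add: h_def)
  have "N #> (inv k \<otimes> (s \<otimes> inv g)) = N #> (inv k \<otimes> k)"
    by (rule coset_mult[OF Nn _ _ _ _ refl k(2)]) (simp_all add: kc sc g)
  then have "N #> (inv k \<otimes> (s \<otimes> inv g) \<otimes> g) = N #> (inv k \<otimes> k \<otimes> g)"
    by (rule coset_mult[OF Nn _ _ _ _ _ refl, rotated 4]) (simp_all add: kc sc g)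
  then have "N #> h = N #> g" using kc sc g by (simp add: h_def m_assoc)
  then have "D #> h \<in> W" using N(2) hc by simp
  moreover have "D #> h = D #> s"
    using r_coset_eq_iff[OF Ds hc sc] subgroup.m_inv_closed[OF Ds k(1)] kc sc by (simp add: h_def m_assoc)
  ultimately show "\<exists>y. y \<in> (\<lambda>s. D #> s) ` S \<and> y \<in> W" using s(1) by auto
qed

end


section \<open>Centralizers of powers of basis elements\<close>

theorem proposition0p0p4:
  fixes C :: "nat monoid set" and F :: "'a monoid" and T :: "'a topology" and B :: "'a set"
    and m :: nat
  assumes "full_class C"
    and "\<exists>K\<in>C. carrier K \<noteq> {\<one>\<^bsub>K\<^esub>}"
    and "free_pro_C_group C F T B"
    and "m \<ge> 2"
  shows "\<forall>x\<in>B. \<forall>n::int. n \<noteq> 0 \<longrightarrow>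
    centralizer (derived_quotient F T m)
        ((closed_derived F T m #>\<^bsub>F\<^esub> x) [^]\<^bsub>derived_quotient F T m\<^esub> n) =
      top_generated (derived_quotient F T m) (derived_quotient_topology F T m)
        {closed_derived F T m #>\<^bsub>F\<^esub> x}"
proof (intro ballI allI impI)
  fix x and n :: int assume x: "x \<in> B" and n: "n \<noteq> 0"
  obtain K where K: "K \<in> C" "carrier K \<noteq> {\<one>\<^bsub>K\<^esub>}" using assms(2) by metis
  interpret free_pro_C C F T B
    using assms(1,3) K(1) by unfold_locales auto
  let ?D = "closed_derived F T m" and ?Q = "derived_quotient F T m" and ?S = "derived_quotient_topology F T m"
  have Dn: "?D \<lhd> F" by (rule closed_derived_normal)
  interpret Q: group ?Q by (rule normal.factorgroup_is_group[OF Dn])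
  have xF: "x \<in> carrier F" using x basis_subset by (rule rev_subsetD)
  have xQ: "?D #>\<^bsub>F\<^esub> x \<in> carrier ?Q" using xF by (simp add: carrier_FactGroup)
  have gK: "group K" and fK: "finite (carrier K)" using full_class_memD[OF full K(1)] by simp_all
  have "order K \<noteq> 1"
  proof
    assume "order K = 1"
    then obtain u where "carrier K = {u}" unfolding order_def by (auto simp: card_1_singleton_iff)
    then show False using K(2) monoid.one_closed[OF group.is_monoid[OF gK]] by simp
  qed
  then obtain q where q: "prime q" "q dvd order K" using prime_factor_nat by metis
  have "in_class C K" unfolding in_class_def using K(1) gK iso_refl by metis
  then have qC: "in_class C (integer_mod_group q)" by (rule in_class_prime_cyclic[OF full nonempty _ q])
  have pow: "(?D #>\<^bsub>F\<^esub> x) [^]\<^bsub>?Q\<^esub> j = ?D #>\<^bsub>F\<^esub> (x [^]\<^bsub>F\<^esub> j)" for j :: int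
    by (rule normal.FactGroup_int_pow[OF Dn xF])
  have pow_gen: "generate ?Q {?D #>\<^bsub>F\<^esub> x} = (\<lambda>s. ?D #>\<^bsub>F\<^esub> s) ` range (\<lambda>j::int. x [^]\<^bsub>F\<^esub> j)"
    using Q.generate_pow[OF xQ] pow by auto
  show "centralizer ?Q ((?D #>\<^bsub>F\<^esub> x) [^]\<^bsub>?Q\<^esub> n) = top_generated ?Q ?S {?D #>\<^bsub>F\<^esub> x}"
  proof
    show "top_generated ?Q ?S {?D #>\<^bsub>F\<^esub> x} \<subseteq> centralizer ?Q ((?D #>\<^bsub>F\<^esub> x) [^]\<^bsub>?Q\<^esub> n)"
      unfolding top_generated_def
    proof (rule closure_of_minimal)
      show "generate ?Q {?D #>\<^bsub>F\<^esub> x} \<subseteq> centralizer ?Q ((?D #>\<^bsub>F\<^esub> x) [^]\<^bsub>?Q\<^esub> n)"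
        by (rule Q.generate_subset_centralizer_pow[OF xQ])
      show "closedin ?S (centralizer ?Q ((?D #>\<^bsub>F\<^esub> x) [^]\<^bsub>?Q\<^esub> n))"
        unfolding pow using xF by (intro closedin_centralizer_quotient[OF Dn closedin_closed_derived]) simp
    qed
    show "centralizer ?Q ((?D #>\<^bsub>F\<^esub> x) [^]\<^bsub>?Q\<^esub> n) \<subseteq> top_generated ?Q ?S {?D #>\<^bsub>F\<^esub> x}"
    proof
      fix u assume u: "u \<in> centralizer ?Q ((?D #>\<^bsub>F\<^esub> x) [^]\<^bsub>?Q\<^esub> n)"
      then obtain g where g: "g \<in> carrier F" "u = ?D #>\<^bsub>F\<^esub> g"
        by (auto simp: centralizer_def carrier_FactGroup)
      have xn: "x [^]\<^bsub>F\<^esub> j \<in> carrier F" for j :: int using xF by simp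
      have comm: "?D #>\<^bsub>F\<^esub> (g \<otimes>\<^bsub>F\<^esub> x [^]\<^bsub>F\<^esub> n) = ?D #>\<^bsub>F\<^esub> (x [^]\<^bsub>F\<^esub> n \<otimes>\<^bsub>F\<^esub> g)"
        using u g normal.rcos_sum[OF Dn g(1) xn] normal.rcos_sum[OF Dn xn g(1)]
        by (simp add: centralizer_def pow)
      have comm_nat: "?D #>\<^bsub>F\<^esub> (g \<otimes>\<^bsub>F\<^esub> x [^]\<^bsub>F\<^esub> nat \<bar>n\<bar>) = ?D #>\<^bsub>F\<^esub> (x [^]\<^bsub>F\<^esub> nat \<bar>n\<bar> \<otimes>\<^bsub>F\<^esub> g)"
      proof (cases "n \<ge> 0")
        case True
        then show ?thesis using comm by (simp flip: int_pow_int)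
      next
        case False
        then have "n = - int (nat \<bar>n\<bar>)" by simp
        then have "x [^]\<^bsub>F\<^esub> n = inv\<^bsub>F\<^esub> (x [^]\<^bsub>F\<^esub> nat \<bar>n\<bar>)"
          using int_pow_neg[OF xF, of "int (nat \<bar>n\<bar>)"] by (metis int_pow_int)
        then show ?thesis
          using coset_commute_inv[OF Dn g(1), of "x [^]\<^bsub>F\<^esub> nat \<bar>n\<bar>"] comm xF by simp
      qed
      have n0: "nat \<bar>n\<bar> > 0" using n by simp
      obtain i where i: "m = Suc (Suc i)" using assms(4) by (metis add_2_eq_Suc le_Suc_ex)
      have "\<exists>s\<in>range (\<lambda>j::int. x [^]\<^bsub>F\<^esub> j). N #>\<^bsub>F\<^esub> g = N #>\<^bsub>F\<^esub> s"
        if N: "open_normal F T N" "?D \<subseteq> N" for N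
        using centralizer_of_power_mod_derived[OF N(1) N(2)[unfolded i] x n0 g(1) comm_nat[unfolded i] q(1) qC]
        by blast
      then have "?D #>\<^bsub>F\<^esub> g \<in> ?S closure_of ((\<lambda>s. ?D #>\<^bsub>F\<^esub> s) ` range (\<lambda>j::int. x [^]\<^bsub>F\<^esub> j))"
        using xn by (intro in_closure_quotient[OF Dn g(1)]) auto
      then show "u \<in> top_generated ?Q ?S {?D #>\<^bsub>F\<^esub> x}"
        using g(2) by (simp only: top_generated_def pow_gen)
    qed
  qed
qed

end
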